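(* Let $m \geq 1$, let $X_1,\dots,X_m$ be separated locally convex spaces, let $f_i : X_i \rightarrow \overline{\mathbb{R}}$ be proper and convex functions, $i=1,\dots,m$, let $S \subseteq \prod_{i=1}^m X_i$ be a linear closed subspace such that $\prod_{i=1}^m \operatorname{dom} f_i \cap S \neq \emptyset$, and let $g:\prod_{i=1}^{m} X_i\rightarrow\overline{\mathbb{R}}$ be defined by $g(x_1,\dots,x_m)=\sum_{i=1}^{m}f_i(x_i)$. Suppose further that $\operatorname{cl} f_i$, $i=1,\dots,m$, are proper functions and that $g(x)=(\operatorname{cl} g)(x)$ for all $x\in\operatorname{dom}(\operatorname{cl} g)\cap S$. If for all $(x_1,\dots,x_m)\in \prod_{i=1}^{m} \operatorname{dom} f_i \cap S$ and all $\varepsilon>0$ the set $$S^\bot+\prod_{i=1}^{m}\partial_{\varepsilon}f_i(x_i)$$ is closed (in $\prod_{i=1}^m X_i^*$), then $v(P)=v(D)$, where $$v(P)=\inf\left\{\sum_{i=1}^m f_i(x_i) : (x_1,\dots,x_m)\in S\right\},\qquad v(D)=\sup\left\{-\sum_{i=1}^m f_i^*(x_i^* ) : (x_1^*,\dots,x_m^* )\in S^\bot\right\}.$$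
   Context: All spaces are real; "separated" means Hausdorff, and $\overline{\mathbb{R}}=\mathbb{R}\cup\{\pm\infty\}$. For a separated locally convex space $X$, $X^*$ denotes its topological dual, endowed with the weak$^*$ topology, and $\langle x^*,x\rangle = x^*(x)$. The dual of $\prod_{i=1}^m X_i$ is identified with $\prod_{i=1}^m X_i^*$ via $\langle (x_1^*,\dots,x_m^* ),(x_1,\dots,x_m)\rangle=\sum_{i=1}^m\langle x_i^*,x_i\rangle$; its weak$^*$ topology is the product of the weak$^*$ topologies, and closedness is meant in this topology. For a linear subspace $S\subseteq X$, $S^\bot=\{x^*\in X^*:\langle x^*,x\rangle=0\ \forall x\in S\}$. For $f:X\to\overline{\mathbb{R}}$: $\operatorname{dom} f=\{x\in X: f(x)<+\infty\}$; $\operatorname{epi} f=\{(x,r)\in X\times\mathbb{R}: f(x)\le r\}$; $f$ is proper if $f(x)>-\infty$ for all $x\in X$ and $\operatorname{dom} f\neq\emptyset$; the conjugate of $f$ is $f^*:X^*\to\overline{\mathbb{R}}$, $f^*(x^* )=\sup\{\langle x^*,x\rangle-f(x):x\in X\}$; the lower semicontinuous hull $\operatorname{cl} f:X\to\overline{\mathbb{R}}$ is the function whose epigraph is the closure of $\operatorname{epi} f$ in $X\times\mathbb{R}$. For $\varepsilon\ge 0$, the $\varepsilon$-subdifferential of $f$ at $x$ is $\partial_\varepsilon f(x)=\{x^*\in X^*: f(y)-f(x)\ge\langle x^*,y-x\rangle-\varepsilon\ \forall y\in X\}$ if $f(x)\in\mathbb{R}$, and $\partial_\varepsilon f(x)=\emptyset$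 if $f(x)=\pm\infty$. *)

theory Defs
  imports "HOL-Analysis.Analysis" "HOL-Library.Function_Algebras" "HOL-Library.Set_Algebras"
begin

instantiation "fun" :: (type, real_vector) real_vector
begin

definition scaleR_fun :: "real \<Rightarrow> ('a \<Rightarrow> 'b) \<Rightarrow> 'a \<Rightarrow> 'b" where
  "scaleR_fun c f = (\<lambda>x. c *\<^sub>R f x)"

instance
  by standard (simp_all add: scaleR_fun_def fun_eq_iff scaleR_add_left scaleR_add_right)

end

(* A locally convex space is an abstract topology whose carrier is a linear subspace of an
   ambient real vector space 'a.  The ambient space carries no topology, so a family
   X :: 'm => 'a topology is an arbitrary finite family of locally convex spaces: the members may
   have unrelated carriers and topologies (any family of real vector spaces embeds linearly in one
   space, for instance in its direct sum).  The product of the family is product_topology X UNIV;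
   its points are functions 'm => 'a, with the pointwise operations. *)

definition separated_lcs :: "'a::real_vector topology \<Rightarrow> bool" where
  "separated_lcs X \<longleftrightarrow>
     subspace (topspace X) \<and>
     Hausdorff_space X \<and>
     continuous_map (prod_topology X X) X (\<lambda>(x, y). x + y) \<and>
     continuous_map (prod_topology euclideanreal X) X (\<lambda>(c, x). c *\<^sub>R x) \<and>
     neighbourhood_base_at 0 convex X"

(* Functionals are set to 0 outside the carrier, so that equality of functionals is equality
   on the carrier and the pointwise sum of two functionals is again one. *)

definition lcs_dual :: "'a::real_vector topology \<Rightarrow> ('a \<Rightarrow> real) set" where
  "lcs_dual X =
     {\<phi>. (\<forall>x\<in>topspace X. \<forall>y\<in>topspace X. \<phi> (x + y) = \<phi> x + \<phi> y) \<and>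
          (\<forall>c. \<forall>x\<in>topspace X. \<phi> (c *\<^sub>R x) = c * \<phi> x) \<and>
          continuous_map X euclideanreal \<phi> \<and>
          (\<forall>x. x \<notin> topspace X \<longrightarrow> \<phi> x = 0)}"

(* The topology of pointwise convergence on X; the coordinates outside the carrier of X
   are constantly 0 on the dual and contribute nothing. *)

definition weak_star :: "'a::real_vector topology \<Rightarrow> ('a \<Rightarrow> real) topology" where
  "weak_star X = subtopology (product_topology (\<lambda>_. euclideanreal) UNIV) (lcs_dual X)"

(* The annihilator in the dual of the product, which is identified with the product
   of the duals through the pairing (\<phi>, x) |-> \<Sum>i. \<phi> i (x i). *)

definition annihilator ::
    "('m::finite \<Rightarrow> 'a::real_vector topology) \<Rightarrow> ('m \<Rightarrow> 'a) set \<Rightarrow> ('m \<Rightarrow> 'a \<Rightarrow> real) set" where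
  "annihilator X S = {\<phi> \<in> (\<Pi> i\<in>UNIV. lcs_dual (X i)). \<forall>x\<in>S. (\<Sum>i\<in>UNIV. \<phi> i (x i)) = 0}"

(* In all notions below, a function on X is a function on the ambient type of which only the
   values on topspace X matter. *)

definition effective_domain :: "'b topology \<Rightarrow> ('b \<Rightarrow> ereal) \<Rightarrow> 'b set" where
  "effective_domain X f = {x \<in> topspace X. f x < \<infinity>}"

definition ereal_epigraph :: "'b topology \<Rightarrow> ('b \<Rightarrow> ereal) \<Rightarrow> ('b \<times> real) set" where
  "ereal_epigraph X f = {(x, r). x \<in> topspace X \<and> f x \<le> ereal r}"

definition proper_function :: "'b topology \<Rightarrow> ('b \<Rightarrow> ereal) \<Rightarrow> bool" where
  "proper_function X f \<longleftrightarrow> (\<forall>x\<in>topspace X. f x > -\<infinity>) \<and> effective_domain X f \<noteq> {}"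

definition convex_function :: "'b::real_vector topology \<Rightarrow> ('b \<Rightarrow> ereal) \<Rightarrow> bool" where
  "convex_function X f \<longleftrightarrow> convex (ereal_epigraph X f)"

definition fenchel_conjugate ::
    "'a::real_vector topology \<Rightarrow> ('a \<Rightarrow> ereal) \<Rightarrow> ('a \<Rightarrow> real) \<Rightarrow> ereal" where
  "fenchel_conjugate X f \<phi> = (SUP x\<in>topspace X. ereal (\<phi> x) - f x)"

definition eps_subdifferential ::
    "'a::real_vector topology \<Rightarrow> real \<Rightarrow> ('a \<Rightarrow> ereal) \<Rightarrow> 'a \<Rightarrow> ('a \<Rightarrow> real) set" where
  "eps_subdifferential X \<epsilon> f x =
     (if x \<in> topspace X \<and> \<bar>f x\<bar> \<noteq> \<infinity>
      then {\<phi> \<in> lcs_dual X. \<forall>y\<in>topspace X. f y - f x \<ge> ereal (\<phi> (y - x) - \<epsilon>)}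
      else {})"

(* The function whose epigraph is the closure of the epigraph of f; see
   ereal_epigraph_lsc_hull and lsc_hull_unique. *)

definition lsc_hull :: "'b topology \<Rightarrow> ('b \<Rightarrow> ereal) \<Rightarrow> 'b \<Rightarrow> ereal" where
  "lsc_hull X f x =
     (INF r\<in>{r. (x, r) \<in> prod_topology X euclideanreal closure_of ereal_epigraph X f}. ereal r)"

lemma closure_ereal_epigraph_mono:
  assumes "(x, r) \<in> prod_topology X euclideanreal closure_of ereal_epigraph X f" and "r \<le> s"
  shows "(x, s) \<in> prod_topology X euclideanreal closure_of ereal_epigraph X f"
proof -
  let ?T = "prod_topology X euclideanreal"
  let ?h = "\<lambda>p::'a \<times> real. (fst p, snd p + (s - r))"
  have snd: "continuous_map ?T euclideanreal snd"
    by (rule continuous_map_snd)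
  have "continuous_map ?T euclideanreal (\<lambda>p. snd p + (s - r))"
    by (intro continuous_map_add snd) auto
  then have "continuous_map ?T ?T ?h"
    by (simp add: continuous_map_pairedI continuous_map_fst)
  then have "?h ` (?T closure_of ereal_epigraph X f) \<subseteq> ?T closure_of (?h ` ereal_epigraph X f)"
    by (simp add: continuous_map_image_closure_subset)
  also have "\<dots> \<subseteq> ?T closure_of ereal_epigraph X f"
  proof (rule closure_of_mono)
    show "?h ` ereal_epigraph X f \<subseteq> ereal_epigraph X f"
      using \<open>r \<le> s\<close> by (auto simp: ereal_epigraph_def intro: order_trans)
  qed
  finally show ?thesis
    using assms(1) by force
qed

lemma ereal_epigraph_lsc_hull:
  "ereal_epigraph X (lsc_hull X f) = prod_topology X euclideanreal closure_of ereal_epigraph X f"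
    (is "_ = ?C")
proof (intro set_eqI iffI)
  fix p assume "p \<in> ?C"
  then obtain x r where p: "p = (x, r)" and xr: "(x, r) \<in> ?C"
    by (cases p) auto
  have "?C \<subseteq> topspace X \<times> UNIV"
    using closure_of_subset_topspace[of "prod_topology X euclideanreal" "ereal_epigraph X f"]
    by simp
  then show "p \<in> ereal_epigraph X (lsc_hull X f)"
    using xr by (auto simp: p ereal_epigraph_def lsc_hull_def intro: INF_lower)
next
  fix p assume "p \<in> ereal_epigraph X (lsc_hull X f)"
  then obtain x r where p: "p = (x, r)" and x: "x \<in> topspace X" and le: "lsc_hull X f x \<le> ereal r"
    by (auto simp: ereal_epigraph_def)
  have above: "(x, s) \<in> ?C" if "r < s" for s
  proof -
    have "lsc_hull X f x < ereal s"
      using le that by (meson ereal_less_le less_ereal.simps(1) order_le_less_trans)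
    then obtain t where "(x, t) \<in> ?C" "t < s"
      unfolding lsc_hull_def by (auto simp: INF_less_iff)
    then show ?thesis
      using closure_ereal_epigraph_mono less_imp_le by metis
  qed
  have cont: "continuous_map euclideanreal (prod_topology X euclideanreal) (\<lambda>t. (x, t))"
    using x by (simp add: continuous_map_pairedI)
  have "closedin euclideanreal {t \<in> topspace euclideanreal. (x, t) \<in> ?C}"
    by (rule closedin_continuous_map_preimage[OF cont closedin_closure_of])
  then have "closed {t. (x, t) \<in> ?C}"
    by simp
  moreover have "{r<..} \<subseteq> {t. (x, t) \<in> ?C}"
    using above by auto
  ultimately have "closure {r<..} \<subseteq> {t. (x, t) \<in> ?C}"
    by (rule closure_minimal[rotated])
  then show "p \<in> ?C"
    by (auto simp: p)
qed

lemma lsc_hull_unique: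
  assumes "ereal_epigraph X h = prod_topology X euclideanreal closure_of ereal_epigraph X f"
    and "x \<in> topspace X"
  shows "h x = lsc_hull X f x"
proof -
  have "ereal_epigraph X h = ereal_epigraph X (lsc_hull X f)"
    by (simp add: assms(1) ereal_epigraph_lsc_hull)
  then have "h x \<le> ereal r \<longleftrightarrow> lsc_hull X f x \<le> ereal r" for r
    using assms(2) by (auto simp: ereal_epigraph_def set_eq_iff)
  then show ?thesis
    by (meson antisym ereal_le_real)
qed

end

theory Submission
  imports Defs
begin

text \<open>
  Weak duality is the inequality of Fenchel and Young, summed over the components. The other
  inequality is trivial if \<open>v(P) = - \<infinity>\<close>. Otherwise let \<open>\<epsilon> > 0\<close> and let
  \<open>x \<in> S\<close> be a feasible point with \<open>g x < v(P) + \<epsilon>\<close>. It suffices to find \<open>\<phi>\<close> in the annihilator of \<open>S\<close> with \<open>\<phi> i \<in> \<partial>\<^sub>\<epsilon> (f i) (x i)\<close> for all \<open>i\<close>: then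
  \<open>(f i)\<^sup>* (\<phi> i) \<le> \<phi> i (x i) - f i (x i) + \<epsilon>\<close>, and since \<open>\<phi>\<close> vanishes at \<open>x\<close>, adding over the
  \<open>m\<close> components shows that \<open>\<phi>\<close> has dual value at least \<open>g x - m \<epsilon> \<ge> v(P) - m \<epsilon>\<close>.

  As the annihilator is a subspace, such a \<open>\<phi>\<close> exists iff \<open>0\<close> lies in the set \<open>C\<close> of all
  \<open>\<psi> + \<phi>\<close> with \<open>\<psi>\<close> in the annihilator and \<open>\<phi> i \<in> \<partial>\<^sub>\<epsilon> (f i) (x i)\<close>
  (\<open>eps_minimizer_annihilating_subgradients\<close>). Here \<open>C\<close> is convex and weak\<open>*\<close> closed, so if it
  misses \<open>0\<close> then some point \<open>d\<close> of the product of the spaces satisfies \<open>\<phi> d \<ge> 1\<close> for all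
  \<open>\<phi> \<in> C\<close> (\<open>weak_star_separation\<close>). A linear functional that is bounded below on a subspace
  vanishes there; so the annihilator of \<open>S\<close> vanishes at \<open>d\<close>, and \<open>d \<in> S\<close> because \<open>S\<close> is closed
  (\<open>closed_subspace_bipolar\<close>).

  Now the line \<open>x + t d\<close> stays in \<open>S\<close>, where \<open>g\<close> is above \<open>g x - \<epsilon>\<close>; since \<open>g\<close> agrees with its
  lower semicontinuous hull at the points of \<open>S\<close> where the hull is below \<open>\<infinity>\<close>, the points
  \<open>(x + t d, g x - \<epsilon>)\<close> lie outside the closure of the epigraph of \<open>g\<close>. A long compact segment of
  them can be separated from the epigraph, which gives an \<open>\<epsilon>\<close>-subgradient \<open>\<phi>\<close> of \<open>g\<close> at \<open>x\<close>; the
  longer the segment, the smaller \<open>\<phi> d\<close> (\<open>eps_subgradient_small_along_segment\<close>). Since \<open>g\<close> is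
  a sum over the components, \<open>\<phi> \<in> C\<close>, and \<open>\<phi> d < 1\<close> is a contradiction.

  All three separations are instances of one algebraic theorem, \<open>convex_separation\<close>, which needs
  no topology: a convex set is separated from a disjoint convex absorbing set.
\<close>

section \<open>Hahn-Banach separation in real vector spaces\<close>

definition sublinear :: "('v::real_vector \<Rightarrow> real) \<Rightarrow> bool" where
  "sublinear p \<longleftrightarrow> (\<forall>v w. p (v + w) \<le> p v + p w) \<and> (\<forall>c\<ge>0. \<forall>v. p (c *\<^sub>R v) = c * p v)"

lemma sublinear_zero: "sublinear p \<Longrightarrow> p 0 = 0"
  unfolding sublinear_def by (metis mult_zero_left order_refl scale_zero_left)

lemma sublinear_ge_neg:
  assumes "sublinear p"
  shows "- p (- v) \<le> p v"
proof -
  have "p (v + - v) \<le> p v + p (- v)"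
    using assms unfolding sublinear_def by blast
  then show ?thesis
    using sublinear_zero[OF assms] by simp
qed

text \<open>
  Here \<open>q v\<close> is the infimum of \<open>p (v + t a) - t \<beta>\<close> over \<open>t \<ge> 0\<close> and \<open>a \<in> A\<close> (the construction of Mazur and
  Orlicz). It has two uses: with \<open>A\<close> a singleton it shows that minimal sublinear functionals are
  linear, and with a general \<open>A\<close> it forces every linear functional below \<open>q\<close> to be at least \<open>\<beta>\<close>
  on \<open>A\<close>.
\<close>

lemma sublinear_lowering:
  fixes p :: "'v::real_vector \<Rightarrow> real"
  assumes p: "sublinear p" and A: "convex A" "A \<noteq> {}" and lb: "\<And>a. a \<in> A \<Longrightarrow> \<beta> \<le> p a"
  obtains q where "sublinear q" "\<And>v. q v \<le> p v" "\<And>a. a \<in> A \<Longrightarrow> q (- a) \<le> - \<beta>"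
proof -
  \<comment> \<open>K is the convex cone generated by A at height \<beta>; q is an infimal convolution with it.\<close>
  define K where "K = {(t *\<^sub>R a, t * \<beta>) | t a. 0 \<le> t \<and> a \<in> A}"
  have p_add: "p (v + w) \<le> p v + p w" for v w
    using p by (auto simp: sublinear_def)
  have p_scale: "p (c *\<^sub>R v) = c * p v" if "0 \<le> c" for c v
    using p that by (auto simp: sublinear_def)
  have K0: "(0, 0) \<in> K"
    using A(2) by (force simp: K_def)
  have K_lb: "r \<le> p k" if "(k, r) \<in> K" for k r
    using that lb by (auto simp: K_def p_scale mult_left_mono)
  have K_scale: "(c *\<^sub>R k, c * r) \<in> K" if kr: "(k, r) \<in> K" and "0 \<le> c" for k r c
  proof -
    obtain t a where "k = t *\<^sub>R a" "r = t * \<beta>" "0 \<le> t" "a \<in> A"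
      using kr by (auto simp: K_def)
    then have "c *\<^sub>R k = (c * t) *\<^sub>R a \<and> c * r = (c * t) * \<beta> \<and> 0 \<le> c * t \<and> a \<in> A"
      using that by simp
    then show ?thesis
      unfolding K_def by blast
  qed
  have K_add: "(k + l, r + s) \<in> K" if kr: "(k, r) \<in> K" and ls: "(l, s) \<in> K" for k l r s
  proof -
    obtain t a where k: "k = t *\<^sub>R a" "r = t * \<beta>" "0 \<le> t" "a \<in> A"
      using kr by (auto simp: K_def)
    obtain u b where l: "l = u *\<^sub>R b" "s = u * \<beta>" "0 \<le> u" "b \<in> A"
      using ls by (auto simp: K_def)
    show ?thesis
    proof (cases "t + u = 0")
      case True
      then have "t = 0" "u = 0"
        using k l by auto
      then show ?thesis
        using k l K0 by simp
    next
      case False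
      then have pos: "0 < t + u"
        using k l by simp
      let ?c = "(t / (t + u)) *\<^sub>R a + (u / (t + u)) *\<^sub>R b"
      have "?c \<in> A"
        using k l pos by (intro convexD[OF A(1)]) (auto simp: add_divide_distrib[symmetric])
      moreover have "k + l = (t + u) *\<^sub>R ?c"
        using pos k l by (simp add: scaleR_add_right)
      moreover have "r + s = (t + u) * \<beta>"
        using k l by (simp add: distrib_right)
      ultimately show ?thesis
        unfolding K_def using pos by (intro CollectI exI[of _ "t + u"] exI[of _ ?c]) auto
    qed
  qed
  define q where "q v = (INF (k, r)\<in>K. p (v + k) - r)" for v
  have below: "- p (- v) \<le> p (v + k) - r" if "(k, r) \<in> K" for v k r
    using K_lb[OF that] p_add[of "v + k" "- v"] by simp
  have bdd: "bdd_below ((\<lambda>(k, r). p (v + k) - r) ` K)" for v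
    by (rule bdd_belowI2[of _ "- p (- v)"]) (use below in auto)
  have q_le: "q v \<le> p (v + k) - r" if "(k, r) \<in> K" for v k r
    unfolding q_def using cINF_lower[OF bdd that] by simp
  have q_approx: "\<exists>k r. (k, r) \<in> K \<and> p (v + k) - r < q v + e" if "0 < e" for v e
  proof -
    have "K \<noteq> {}"
      using K0 by blast
    moreover have "(INF (k, r)\<in>K. p (v + k) - r) < q v + e"
      using that by (simp add: q_def)
    ultimately show ?thesis
      using cINF_less_iff[OF _ bdd] by fastforce
  qed
  have q_add: "q (v + w) \<le> q v + q w" for v w
  proof (rule field_le_epsilon)
    fix e :: real assume "0 < e"
    then obtain k r l s where kr: "(k, r) \<in> K" "p (v + k) - r < q v + e / 2"
      and ls: "(l, s) \<in> K" "p (w + l) - s < q w + e / 2"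
      using q_approx[of "e / 2" v] q_approx[of "e / 2" w] by auto
    have "q (v + w) \<le> p ((v + k) + (w + l)) - (r + s)"
      using q_le[OF K_add[OF kr(1) ls(1)], of "v + w"] by (simp add: algebra_simps)
    also have "\<dots> \<le> q v + q w + e"
      using p_add[of "v + k" "w + l"] kr ls by linarith
    finally show "q (v + w) \<le> q v + q w + e" .
  qed
  have q_scale_le: "q (c *\<^sub>R v) \<le> c * q v" if c: "0 < c" for c v
  proof (rule field_le_epsilon)
    fix e :: real assume "0 < e"
    then obtain k r where kr: "(k, r) \<in> K" "p (v + k) - r < q v + e / c"
      using q_approx[of "e / c" v] c by auto
    have "q (c *\<^sub>R v) \<le> p (c *\<^sub>R (v + k)) - c * r"
      using q_le[OF K_scale[OF kr(1), of c], of "c *\<^sub>R v"] c by (simp add: scaleR_add_right)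
    also have "\<dots> = c * (p (v + k) - r)"
      using c by (simp add: p_scale right_diff_distrib)
    also have "\<dots> \<le> c * (q v + e / c)"
      using kr c by (intro mult_left_mono) auto
    also have "\<dots> = c * q v + e"
      using c by (simp add: field_simps)
    finally show "q (c *\<^sub>R v) \<le> c * q v + e" .
  qed
  have q_0: "q 0 = 0"
  proof (rule antisym)
    show "q 0 \<le> 0"
      using q_le[OF K0, of 0] sublinear_zero[OF p] by simp
    show "0 \<le> q 0"
      unfolding q_def using below[of _ _ 0] sublinear_zero[OF p] K0
      by (intro cINF_greatest) auto
  qed
  have "q (c *\<^sub>R v) = c * q v" if "0 \<le> c" for c v
  proof (cases "c = 0")
    case True
    then show ?thesis
      using q_0 by simp
  next
    case False
    then have "0 < c"
      using that by simp
    then have "c * q v \<le> q (c *\<^sub>R v)"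
      using q_scale_le[of "1 / c" "c *\<^sub>R v"] by (simp add: field_simps)
    then show ?thesis
      using q_scale_le[OF \<open>0 < c\<close>, of v] by simp
  qed
  then have "sublinear q"
    using q_add by (simp add: sublinear_def)
  moreover have "q v \<le> p v" for v
    using q_le[OF K0, of v] by simp
  moreover have "q (- a) \<le> - \<beta>" if "a \<in> A" for a
  proof -
    have "(a, \<beta>) \<in> K"
      unfolding K_def using that by (intro CollectI exI[of _ 1] exI[of _ a]) auto
    then show ?thesis
      using q_le[of a \<beta> "- a"] sublinear_zero[OF p] by simp
  qed
  ultimately show ?thesis
    using that by blast
qed

text \<open>
  Lowering \<open>q\<close> in the direction \<open>a\<close> with \<open>\<beta> = q a\<close> changes nothing by minimality, which is the
  missing inequality \<open>q (- a) \<le> - q a\<close>.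
\<close>

lemma minimal_sublinear_imp_linear:
  assumes q: "sublinear q"
    and minimal: "\<And>q'. sublinear q' \<Longrightarrow> (\<And>v. q' v \<le> q v) \<Longrightarrow> q' = q"
  shows "linear q"
proof -
  have neg: "q (- a) = - q a" for a
  proof (rule antisym)
    obtain q' where "sublinear q'" "\<And>v. q' v \<le> q v" "q' (- a) \<le> - q a"
      by (rule sublinear_lowering[OF q, of "{a}" "q a"]) auto
    then show "q (- a) \<le> - q a"
      using minimal by blast
    show "- q a \<le> q (- a)"
      using sublinear_ge_neg[OF q, of "- a"] by simp
  qed
  have add: "q (v + w) \<le> q v + q w" for v w
    using q by (auto simp: sublinear_def)
  have pos: "q (c *\<^sub>R v) = c * q v" if "0 \<le> c" for c v
    using q that by (auto simp: sublinear_def)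
  show ?thesis
  proof (rule linearI)
    fix v w
    show "q (v + w) = q v + q w"
      using add[of v w] add[of "v + w" "- w"] neg[of w] by simp
  next
    fix c v
    show "q (c *\<^sub>R v) = c *\<^sub>R q v"
    proof (cases "0 \<le> c")
      case False
      then show ?thesis
        using pos[of "- c" v] neg[of "c *\<^sub>R v"] by simp
    qed (simp add: pos)
  qed
qed

lemma sublinear_INF_chain:
  fixes C :: "('v::real_vector \<Rightarrow> real) set"
  assumes "C \<noteq> {}" and sub: "\<And>q. q \<in> C \<Longrightarrow> sublinear q"
    and bdd: "\<And>v. bdd_below ((\<lambda>q. q v) ` C)"
    and chain: "\<And>q r. q \<in> C \<Longrightarrow> r \<in> C \<Longrightarrow> q \<le> r \<or> r \<le> q"
  shows "sublinear (\<lambda>v. INF q\<in>C. q v)"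
proof -
  let ?m = "\<lambda>v. INF q\<in>C. q v"
  have le: "?m v \<le> q v" if "q \<in> C" for q v
    using cINF_lower[OF bdd that] .
  have approx: "\<exists>q\<in>C. q v < ?m v + e" if "0 < e" for v e
    using cINF_less_iff[OF assms(1) bdd, of v "?m v + e"] that by simp
  have "?m (v + w) \<le> ?m v + ?m w" for v w
  proof (rule field_le_epsilon)
    fix e :: real assume "0 < e"
    then obtain q r where q: "q \<in> C" "q v < ?m v + e / 2" and r: "r \<in> C" "r w < ?m w + e / 2"
      using approx[of "e / 2" v] approx[of "e / 2" w] by auto
    obtain s where s: "s \<in> C" "s v \<le> q v" "s w \<le> r w"
      using chain[OF q(1) r(1)] q(1) r(1) by (auto simp: le_fun_def)
    have "?m (v + w) \<le> s (v + w)"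
      by (rule le[OF s(1)])
    also have "\<dots> \<le> s v + s w"
      using sub[OF s(1)] by (simp add: sublinear_def)
    finally show "?m (v + w) \<le> ?m v + ?m w + e"
      using s q r by simp
  qed
  moreover have "?m (c *\<^sub>R v) = c * ?m v" if "0 \<le> c" for c v
  proof -
    have img: "(\<lambda>q. q (c *\<^sub>R v)) ` C = (\<lambda>q. c * q v) ` C"
      using sub that by (auto simp: sublinear_def intro!: image_cong)
    show ?thesis
    proof (cases "c = 0")
      case True
      then show ?thesis
        using img assms(1) by simp
    next
      case False
      then have c: "0 < c" using that by simp
      have "?m (c *\<^sub>R v) \<le> c * ?m v" 
      proof (rule field_le_epsilon)
        fix e :: real assume "0 < e"
        then obtain q where q: "q \<in> C" "q v < ?m v + e / c"
          using approx[of "e / c" v] c by auto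
        have "?m (c *\<^sub>R v) \<le> c * q v"
          using le[OF q(1), of "c *\<^sub>R v"] sub[OF q(1)] that by (simp add: sublinear_def)
        also have "\<dots> \<le> c * (?m v + e / c)"
          using q c by (intro mult_left_mono) auto
        finally show "?m (c *\<^sub>R v) \<le> c * ?m v + e"
          using c by (simp add: distrib_left)
      qed
      moreover have "c * ?m v \<le> ?m (c *\<^sub>R v)"
        unfolding img by (intro cINF_greatest assms(1) mult_left_mono le that)
      ultimately show ?thesis by simp
    qed
  qed
  ultimately show ?thesis
    by (simp add: sublinear_def)
qed

text \<open>
  The Hahn-Banach theorem: by Zorn's lemma there is a minimal sublinear functional below \<open>p\<close>. Chains
  are bounded below pointwise, because \<open>q v \<ge> - q (- v) \<ge> - p (- v)\<close> for all \<open>q \<le> p\<close>.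
\<close>

lemma linear_below_sublinear:
  fixes p :: "'v::real_vector \<Rightarrow> real"
  assumes p: "sublinear p"
  obtains \<Lambda> :: "'v \<Rightarrow> real" where "linear \<Lambda>" "\<And>v. \<Lambda> v \<le> p v"
proof -
  let ?A = "{q. sublinear q \<and> q \<le> p}"
  let ?P = "\<lambda>q r. r \<le> (q :: 'v \<Rightarrow> real)"
  have "\<exists>m\<in>?A. \<forall>q\<in>?A. ?P m q \<longrightarrow> q = m"
  proof (rule predicate_Zorn)
    show "partial_order_on ?A (relation_of ?P ?A)"
      by (rule partial_order_on_relation_ofI) auto
  next
    fix C assume "C \<in> Chains (relation_of ?P ?A)"
    then have C: "C \<subseteq> ?A" and chain: "\<And>q r. q \<in> C \<Longrightarrow> r \<in> C \<Longrightarrow> q \<le> r \<or> r \<le> q"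
      by (auto simp: Chains_def relation_of_def)
    show "\<exists>u\<in>?A. \<forall>q\<in>C. ?P q u"
    proof (cases "C = {}")
      case True
      then show ?thesis
        using p by auto
    next
      case False
      have bdd: "bdd_below ((\<lambda>q. q v) ` C)" for v
      proof (rule bdd_belowI2)
        fix q assume "q \<in> C"
        then have "sublinear q" "q (- v) \<le> p (- v)"
          using C by (auto simp: le_fun_def)
        then show "- p (- v) \<le> q v"
          using sublinear_ge_neg[of q v] by simp
      qed
      let ?m = "\<lambda>v. INF q\<in>C. q v"
      have le: "?m \<le> q" if "q \<in> C" for q
        using cINF_lower[OF bdd that] by (simp add: le_fun_def)
      have "sublinear ?m"
        using C bdd chain False by (intro sublinear_INF_chain) auto
      moreover have "?m \<le> p"
      proof -
        obtain q where "q \<in> C"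
          using False by blast
        then have "?m \<le> q" "q \<le> p"
          using le C by auto
        then show ?thesis
          by (rule order_trans)
      qed
      ultimately show ?thesis
        using le by blast
    qed
  qed
  then obtain q where q: "sublinear q" "q \<le> p" and min: "\<And>r. sublinear r \<Longrightarrow> r \<le> p \<Longrightarrow> r \<le> q \<Longrightarrow> r = q"
    by auto
  have "linear q"
  proof (rule minimal_sublinear_imp_linear[OF q(1)])
    fix r assume "sublinear r" and "\<And>v. r v \<le> q v"
    moreover from this have "r \<le> q"
      by (simp add: le_fun_def)
    ultimately show "r = q"
      using min q(2) order_trans by blast
  qed
  then show ?thesis
    using that q by (auto simp: le_fun_def)
qed

definition absorbing :: "'v::real_vector set \<Rightarrow> bool" where
  "absorbing U \<longleftrightarrow> (\<forall>v. \<exists>t>0. t *\<^sub>R v \<in> U)"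

definition minkowski_gauge :: "'v::real_vector set \<Rightarrow> 'v \<Rightarrow> real" where
  "minkowski_gauge U v = Inf {t. 0 < t \<and> (1 / t) *\<^sub>R v \<in> U}"

lemma absorbing_zero_mem: "absorbing U \<Longrightarrow> 0 \<in> U"
  unfolding absorbing_def by (metis scaleR_zero_right)

lemma minkowski_gauge_le:
  assumes "0 < t" "(1 / t) *\<^sub>R v \<in> U"
  shows "minkowski_gauge U v \<le> t"
  unfolding minkowski_gauge_def
  by (rule cInf_lower) (use assms in \<open>auto intro!: bdd_belowI[of _ 0]\<close>)

lemma minkowski_gauge_set_nonempty:
  assumes "absorbing U"
  shows "{t. 0 < t \<and> (1 / t) *\<^sub>R v \<in> U} \<noteq> {}"
proof -
  obtain t where "0 < t" "t *\<^sub>R v \<in> U"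
    using assms by (auto simp: absorbing_def)
  then have "1 / t \<in> {t. 0 < t \<and> (1 / t) *\<^sub>R v \<in> U}"
    by simp
  then show ?thesis by blast
qed

lemma minkowski_gauge_approx:
  assumes "absorbing U" "0 < e"
  obtains t where "0 < t" "(1 / t) *\<^sub>R v \<in> U" "t < minkowski_gauge U v + e"
proof -
  have "Inf {t. 0 < t \<and> (1 / t) *\<^sub>R v \<in> U} < minkowski_gauge U v + e"
    using assms(2) by (simp add: minkowski_gauge_def)
  from cInf_lessD[OF minkowski_gauge_set_nonempty[OF assms(1)] this] show ?thesis
    using that by auto
qed

lemma sublinear_minkowski_gauge:
  assumes U: "convex U" "absorbing U"
  shows "sublinear (minkowski_gauge U)"
proof -
  let ?p = "minkowski_gauge U"
  have "?p (v + w) \<le> ?p v + ?p w" for v w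
  proof (rule field_le_epsilon)
    fix e :: real assume "0 < e"
    obtain t where t: "0 < t" "(1 / t) *\<^sub>R v \<in> U" "t < ?p v + e / 2"
      using minkowski_gauge_approx[OF U(2), of "e / 2" v] \<open>0 < e\<close> by auto
    obtain s where s: "0 < s" "(1 / s) *\<^sub>R w \<in> U" "s < ?p w + e / 2"
      using minkowski_gauge_approx[OF U(2), of "e / 2" w] \<open>0 < e\<close> by auto
    have "(t / (t + s)) *\<^sub>R ((1 / t) *\<^sub>R v) + (s / (t + s)) *\<^sub>R ((1 / s) *\<^sub>R w) \<in> U"
      using t s by (intro convexD[OF U(1)]) (auto simp: add_divide_distrib[symmetric])
    also have "(t / (t + s)) *\<^sub>R ((1 / t) *\<^sub>R v) + (s / (t + s)) *\<^sub>R ((1 / s) *\<^sub>R w)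
        = (1 / (t + s)) *\<^sub>R (v + w)"
      using t s by (simp add: scaleR_add_right)
    finally have "?p (v + w) \<le> t + s"
      using t s by (intro minkowski_gauge_le) auto
    then show "?p (v + w) \<le> ?p v + ?p w + e"
      using t s by simp
  qed
  moreover have scale_le: "?p (c *\<^sub>R v) \<le> c * ?p v" if c: "0 < c" for c v
  proof (rule field_le_epsilon)
    fix e :: real assume "0 < e"
    obtain t where t: "0 < t" "(1 / t) *\<^sub>R v \<in> U" "t < ?p v + e / c"
      using minkowski_gauge_approx[OF U(2), of "e / c" v] \<open>0 < e\<close> c by auto
    have "?p (c *\<^sub>R v) \<le> c * t"
      using t c by (intro minkowski_gauge_le) auto
    also have "\<dots> \<le> c * (?p v + e / c)"
      using t c by (intro mult_left_mono) auto
    finally show "?p (c *\<^sub>R v) \<le> c * ?p v + e"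
      using c by (simp add: distrib_left)
  qed
  moreover have "?p (c *\<^sub>R v) = c * ?p v" if "0 \<le> c" for c v
  proof (cases "c = 0")
    case True
    have "(0::'a) \<in> U"
      using U(2) by (rule absorbing_zero_mem)
    then have "{t::real. 0 < t \<and> (1 / t) *\<^sub>R (0::'a) \<in> U} = {0<..}"
      by auto
    then show ?thesis
      using True by (simp add: minkowski_gauge_def)
  next
    case False
    then have "0 < c"
      using that by simp
    then show ?thesis
      using scale_le[of c v] scale_le[of "1 / c" "c *\<^sub>R v"] by (simp add: field_simps)
  qed
  ultimately show ?thesis
    by (simp add: sublinear_def)
qed

lemma minkowski_gauge_ge_1:
  assumes U: "convex U" "absorbing U" and "v \<notin> U"
  shows "1 \<le> minkowski_gauge U v"
  unfolding minkowski_gauge_def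
proof (rule cInf_greatest[OF minkowski_gauge_set_nonempty[OF U(2)]])
  fix t assume "t \<in> {t. 0 < t \<and> (1 / t) *\<^sub>R v \<in> U}"
  then have t: "0 < t" "(1 / t) *\<^sub>R v \<in> U" by auto
  have "0 \<in> U"
    using U(2) by (rule absorbing_zero_mem)
  show "1 \<le> t"
  proof (rule ccontr)
    assume "\<not> 1 \<le> t"
    then have "t *\<^sub>R ((1 / t) *\<^sub>R v) + (1 - t) *\<^sub>R 0 \<in> U"
      using t \<open>0 \<in> U\<close> by (intro convexD[OF U(1)]) auto
    then show False
      using t \<open>v \<notin> U\<close> by simp
  qed
qed

text \<open>
  The Minkowski gauge of \<open>U\<close> is at least \<open>1\<close> outside \<open>U\<close>, in particular on \<open>A\<close>, so it can be
  lowered to a sublinear functional \<open>q\<close> with \<open>q (- a) \<le> - 1\<close> on \<open>A\<close>. Any linear functional below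
  \<open>q\<close> separates.
\<close>

theorem convex_separation:
  fixes U A :: "'v::real_vector set"
  assumes U: "convex U" "absorbing U" and A: "convex A" and disj: "A \<inter> U = {}"
  obtains \<Lambda> :: "'v \<Rightarrow> real" where "linear \<Lambda>" "\<And>u. u \<in> U \<Longrightarrow> \<Lambda> u \<le> 1" "\<And>a. a \<in> A \<Longrightarrow> 1 \<le> \<Lambda> a"
proof (cases "A = {}")
  case True
  show ?thesis
    by (rule that[of "\<lambda>_. 0"]) (auto simp: True linear_iff)
next
  case False
  note gauge = sublinear_minkowski_gauge[OF U]
  obtain q where q: "sublinear q" "\<And>v. q v \<le> minkowski_gauge U v" "\<And>a. a \<in> A \<Longrightarrow> q (- a) \<le> - 1"
    by (rule sublinear_lowering[OF gauge A False, of 1])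
       (use disj in \<open>auto intro!: minkowski_gauge_ge_1[OF U]\<close>)
  obtain \<Lambda> :: "'v \<Rightarrow> real" where \<Lambda>: "linear \<Lambda>" "\<And>v. \<Lambda> v \<le> q v"
    using linear_below_sublinear[OF q(1)] by blast
  show ?thesis
  proof (rule that[OF \<Lambda>(1)])
    show "\<Lambda> u \<le> 1" if "u \<in> U" for u
      using \<Lambda>(2)[of u] q(2)[of u] minkowski_gauge_le[of 1 u U] that by simp
    show "1 \<le> \<Lambda> a" if "a \<in> A" for a
      using \<Lambda>(2)[of "- a"] q(3)[OF that] linear_neg[OF \<Lambda>(1), of a] by simp
  qed
qed

section \<open>Finite products of locally convex spaces\<close>

text \<open>
  Not necessarily open, since local convexity only provides convex sets that contain an open
  neighbourhood.
\<close>

definition convex_zero_nbhd :: "'a::real_vector topology \<Rightarrow> 'a set \<Rightarrow> bool" where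
  "convex_zero_nbhd X U \<longleftrightarrow>
     convex U \<and> U \<subseteq> topspace X \<and> (\<exists>V. openin X V \<and> 0 \<in> V \<and> V \<subseteq> U)"

lemma separated_lcs_subspace: "separated_lcs X \<Longrightarrow> subspace (topspace X)"
  by (simp add: separated_lcs_def)

lemma separated_lcs_continuous_add:
  assumes "separated_lcs X" "continuous_map T X f" "continuous_map T X g"
  shows "continuous_map T X (\<lambda>z. f z + g z)"
proof -
  have "continuous_map T X ((\<lambda>(x, y). x + y) \<circ> (\<lambda>z. (f z, g z)))"
    using assms
    by (intro continuous_map_compose[of _ "prod_topology X X"] continuous_map_pairedI)
       (auto simp: separated_lcs_def)
  then show ?thesis
    by (simp add: o_def)
qed

lemma separated_lcs_continuous_scaleR:
  assumes "separated_lcs X" "continuous_map T euclideanreal c" "continuous_map T X f"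
  shows "continuous_map T X (\<lambda>z. c z *\<^sub>R f z)"
proof -
  have "continuous_map T X ((\<lambda>(c, x). c *\<^sub>R x) \<circ> (\<lambda>z. (c z, f z)))"
    using assms
    by (intro continuous_map_compose[of _ "prod_topology euclideanreal X"] continuous_map_pairedI)
       (auto simp: separated_lcs_def)
  then show ?thesis
    by (simp add: o_def)
qed

lemma zero_in_convex_zero_nbhd: "convex_zero_nbhd X U \<Longrightarrow> 0 \<in> U"
  by (auto simp: convex_zero_nbhd_def)

lemma convex_zero_nbhd_translate:
  assumes X: "separated_lcs X" and W: "openin X W" "y \<in> W"
  obtains U where "convex_zero_nbhd X U" "\<And>u. u \<in> U \<Longrightarrow> y + u \<in> W"
proof -
  have y: "y \<in> topspace X"
    using W openin_subset by blast
  have "continuous_map X X (\<lambda>u. y + u)"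
    using y by (intro separated_lcs_continuous_add X) auto
  then have op: "openin X {u \<in> topspace X. y + u \<in> W}"
    using W(1) by (rule openin_continuous_map_preimage)
  have zero: "0 \<in> topspace X"
    using separated_lcs_subspace[OF X] by (rule subspace_0)
  have base: "\<forall>W. openin X W \<and> 0 \<in> W \<longrightarrow>
      (\<exists>V U. openin X V \<and> convex U \<and> 0 \<in> V \<and> V \<subseteq> U \<and> U \<subseteq> W)"
    using X by (simp add: separated_lcs_def neighbourhood_base_at_def)
  have "openin X {u \<in> topspace X. y + u \<in> W} \<and> 0 \<in> {u \<in> topspace X. y + u \<in> W}"
    using op zero W(2) by simp
  from mp[OF spec[OF base] this] obtain V U where "openin X V" "convex U" "0 \<in> V" "V \<subseteq> U"
      "U \<subseteq> {u \<in> topspace X. y + u \<in> W}"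
    by (elim exE conjE)
  then show ?thesis
    by (intro that[of U]) (auto simp: convex_zero_nbhd_def)
qed

lemma convex_zero_nbhds_translate:
  fixes X :: "'m::finite \<Rightarrow> 'a::real_vector topology"
  assumes X: "\<And>i. separated_lcs (X i)"
    and W: "openin (product_topology X UNIV) W" "y \<in> W"
  obtains U where "\<And>i. convex_zero_nbhd (X i) (U i)" "\<And>u. (\<And>i. u i \<in> U i) \<Longrightarrow> y + u \<in> W"
proof -
  obtain V where V: "\<And>i. openin (X i) (V i)" "y \<in> Pi\<^sub>E UNIV V" "Pi\<^sub>E UNIV V \<subseteq> W"
    using W unfolding openin_product_topology_alt by (metis UNIV_I)
  have "\<exists>U. convex_zero_nbhd (X i) U \<and> (\<forall>u\<in>U. y i + u \<in> V i)" for i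
    using convex_zero_nbhd_translate[OF X V(1), of "y i" i] V(2) by (metis PiE_mem UNIV_I)
  then obtain U where U: "\<And>i. convex_zero_nbhd (X i) (U i)" "\<And>i u. u \<in> U i \<Longrightarrow> y i + u \<in> V i"
    by metis
  show ?thesis
  proof (rule that[OF U(1)])
    fix u assume "\<And>i. u i \<in> U i"
    then have "y + u \<in> Pi\<^sub>E UNIV V"
      using U(2) by (simp add: PiE_UNIV_domain)
    then show "y + u \<in> W"
      using V(3) by blast
  qed
qed

lemma convex_zero_nbhd_absorbs:
  assumes X: "separated_lcs X" and U: "convex_zero_nbhd X U" and a: "a \<in> topspace X"
  obtains t where "0 < t" "\<And>s. 0 \<le> s \<Longrightarrow> s \<le> t \<Longrightarrow> s *\<^sub>R a \<in> U"
proof -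
  obtain V where V: "openin X V" "0 \<in> V" "V \<subseteq> U"
    using U by (auto simp: convex_zero_nbhd_def)
  have "continuous_map euclideanreal X (\<lambda>t. t *\<^sub>R a)"
    using a by (intro separated_lcs_continuous_scaleR X) auto
  then have "openin euclideanreal {t \<in> topspace euclideanreal. t *\<^sub>R a \<in> V}"
    using V(1) by (rule openin_continuous_map_preimage)
  then have "open {t. t *\<^sub>R a \<in> V}"
    by simp
  moreover have "0 \<in> {t. t *\<^sub>R a \<in> V}"
    using V(2) by simp
  ultimately obtain e where e: "0 < e" "ball 0 e \<subseteq> {t. t *\<^sub>R a \<in> V}"
    using open_contains_ball by blast
  show ?thesis
  proof (rule that[of "e / 2"])
    fix s :: real assume "0 \<le> s" "s \<le> e / 2"
    then have "s \<in> ball 0 e"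
      using e(1) by (simp add: dist_real_def)
    then show "s *\<^sub>R a \<in> U"
      using e(2) V(3) by blast
  qed (use e(1) in simp)
qed

lemma mem_topspace_product:
  "x \<in> topspace (product_topology X UNIV) \<longleftrightarrow> (\<forall>i. x i \<in> topspace (X i))"
  by (simp add: PiE_iff)

text \<open>
  Separation takes place in whole vector spaces, while the product of the carriers is only a subspace
  of \<open>'m \<Rightarrow> 'a\<close>. Preimages under a linear projection onto it turn neighbourhoods of \<open>0\<close> in the
  product into absorbing sets of the whole space.
\<close>

lemma product_projection:
  fixes X :: "'m::finite \<Rightarrow> 'a::real_vector topology"
  assumes X: "\<And>i. separated_lcs (X i)"
  obtains \<pi> :: "('m \<Rightarrow> 'a) \<Rightarrow> ('m \<Rightarrow> 'a)" where "linear \<pi>"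
    "\<And>v i. \<pi> v i \<in> topspace (X i)" "\<And>v. (\<And>i. v i \<in> topspace (X i)) \<Longrightarrow> \<pi> v = v"
proof -
  let ?P = "{v :: 'm \<Rightarrow> 'a. \<forall>i. v i \<in> topspace (X i)}"
  have "subspace ?P"
    using separated_lcs_subspace[OF X]
    by (auto simp: subspace_def scaleR_fun_def)
  then obtain \<pi> where "range \<pi> \<subseteq> ?P" "linear \<pi>" "\<forall>v\<in>?P. \<pi> (id v) = v"
    using real_vector.linear_exists_left_inverse_on[of id ?P] linear_id
    unfolding linear_def[symmetric] by (auto simp: inj_on_def)
  then show ?thesis
    by (intro that[of \<pi>]) auto
qed

lemma product_nbhd_absorbs:
  fixes X :: "'m::finite \<Rightarrow> 'a::real_vector topology"
  assumes X: "\<And>i. separated_lcs (X i)" and U: "\<And>i. convex_zero_nbhd (X i) (U i)"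
    and v: "\<And>i. v i \<in> topspace (X i)"
  obtains t where "0 < t" "\<And>s i. 0 \<le> s \<Longrightarrow> s \<le> t \<Longrightarrow> s *\<^sub>R v i \<in> U i"
proof -
  have "\<exists>t>0. \<forall>s. 0 \<le> s \<longrightarrow> s \<le> t \<longrightarrow> s *\<^sub>R v i \<in> U i" for i
    using convex_zero_nbhd_absorbs[OF X U v, of i] by metis
  then obtain t where t: "\<And>i. 0 < t i" "\<And>i s. 0 \<le> s \<Longrightarrow> s \<le> t i \<Longrightarrow> s *\<^sub>R v i \<in> U i"
    by metis
  show ?thesis
  proof (rule that[of "Min (range t)"])
    show "0 < Min (range t)"
      using t(1) by simp
    show "s *\<^sub>R v i \<in> U i" if "0 \<le> s" "s \<le> Min (range t)" for s i
      using that t(2)[of s i] by simp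
  qed
qed

lemma linear_bounded_on_nbhd_imp_continuous:
  fixes \<phi> :: "'a::real_vector \<Rightarrow> real"
  assumes X: "separated_lcs X" and U: "convex_zero_nbhd X U"
    and add: "\<And>a b. a \<in> topspace X \<Longrightarrow> b \<in> topspace X \<Longrightarrow> \<phi> (a + b) = \<phi> a + \<phi> b"
    and scale: "\<And>c a. a \<in> topspace X \<Longrightarrow> \<phi> (c *\<^sub>R a) = c * \<phi> a"
    and le: "\<And>u. u \<in> U \<Longrightarrow> \<phi> u \<le> 1"
  shows "continuous_map X euclideanreal \<phi>"
proof -
  obtain V where V: "openin X V" "0 \<in> V" "V \<subseteq> U"
    using U by (auto simp: convex_zero_nbhd_def)
  have sub: "subspace (topspace X)"
    by (rule separated_lcs_subspace[OF X])
  have "openin X {x \<in> topspace X. \<phi> x \<in> W}" if W: "open W" for W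
  proof (subst openin_subopen, intro ballI)
    fix x assume "x \<in> {x \<in> topspace X. \<phi> x \<in> W}"
    then have x: "x \<in> topspace X" "\<phi> x \<in> W" by auto
    obtain e where e: "0 < e" "ball (\<phi> x) e \<subseteq> W"
      using W x(2) open_contains_ball by blast
    define h where "h k y = k *\<^sub>R (y + (-1) *\<^sub>R x)" for k :: real and y
    have cont: "continuous_map X X (h k)" for k
      unfolding h_def using x(1) subspace_scale[OF sub x(1)]
      by (intro separated_lcs_continuous_scaleR separated_lcs_continuous_add X) auto
    let ?T = "{y \<in> topspace X. h (2 / e) y \<in> V} \<inter> {y \<in> topspace X. h (- (2 / e)) y \<in> V}"
    have \<phi>_h: "\<phi> (h k y) = k * (\<phi> y - \<phi> x)" if "y \<in> topspace X" for k y
    proof -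
      have "(-1) *\<^sub>R x \<in> topspace X"
        using x(1) sub by (rule subspace_scale[rotated])
      then have "\<phi> (h k y) = k * (\<phi> y + \<phi> ((-1) *\<^sub>R x))"
        using that unfolding h_def by (subst scale, intro subspace_add[OF sub], simp_all only: add)
      also have "\<phi> ((-1) *\<^sub>R x) = - \<phi> x"
        using scale[OF x(1), of "-1"] by simp
      finally show ?thesis
        by simp
    qed
    have "openin X ?T"
      using V(1) by (intro openin_Int openin_continuous_map_preimage[OF cont])
    moreover have "x \<in> ?T"
      using x(1) V(2) by (simp add: h_def)
    moreover have "?T \<subseteq> {x \<in> topspace X. \<phi> x \<in> W}"
    proof
      fix y assume y: "y \<in> ?T"
      then have "\<phi> (h (2 / e) y) \<le> 1" "\<phi> (h (- (2 / e)) y) \<le> 1"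
        using le V(3) by blast+
      then have "2 / e * (\<phi> y - \<phi> x) \<le> 1" "- (2 / e) * (\<phi> y - \<phi> x) \<le> 1"
        using y \<phi>_h by simp_all
      then have "2 * (\<phi> y - \<phi> x) \<le> e" "- 2 * (\<phi> y - \<phi> x) \<le> e"
        using e(1) by (simp_all add: field_simps)
      then have "\<phi> y \<in> ball (\<phi> x) e"
        using e(1) by (simp add: dist_real_def abs_if)
      then show "y \<in> {x \<in> topspace X. \<phi> x \<in> W}"
        using e(2) y by blast
    qed
    ultimately show "\<exists>T. openin X T \<and> x \<in> T \<and> T \<subseteq> {x \<in> topspace X. \<phi> x \<in> W}"
      by blast
  qed
  then show ?thesis
    by (simp add: continuous_map_def)
qed

lemma sum_fun_apply: "(\<Sum>i\<in>A. h i) x = (\<Sum>i\<in>A. h i x)"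
  by (induction A rule: infinite_finite_induct) auto

text \<open>
  A functional bounded above on a neighbourhood of \<open>0\<close> restricts to a continuous functional on each
  coordinate axis. This identifies the dual of the product with the product of the duals.
\<close>

lemma product_functional_components:
  fixes X :: "'m::finite \<Rightarrow> 'a::real_vector topology" and \<Lambda> :: "('m \<Rightarrow> 'a) \<Rightarrow> real"
  assumes X: "\<And>i. separated_lcs (X i)" and U: "\<And>i. convex_zero_nbhd (X i) (U i)"
    and \<Lambda>: "linear \<Lambda>" and le: "\<And>u. (\<And>i. u i \<in> U i) \<Longrightarrow> \<Lambda> u \<le> 1"
  obtains \<phi> where "\<And>i. \<phi> i \<in> lcs_dual (X i)"
    "\<And>x. (\<And>i. x i \<in> topspace (X i)) \<Longrightarrow> \<Lambda> x = (\<Sum>i\<in>UNIV. \<phi> i (x i))"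
proof -
  define single :: "'m \<Rightarrow> 'a \<Rightarrow> 'm \<Rightarrow> 'a" where "single i a = (\<lambda>j. if j = i then a else 0)" for i a
  define \<phi> where "\<phi> i a = (if a \<in> topspace (X i) then \<Lambda> (single i a) else 0)" for i a
  have sub: "subspace (topspace (X i))" for i
    by (rule separated_lcs_subspace[OF X])
  have single_add: "single i (a + b) = single i a + single i b" for i a b
    by (auto simp: single_def fun_eq_iff)
  have single_scale: "single i (c *\<^sub>R a) = c *\<^sub>R single i a" for i a c
    by (auto simp: single_def fun_eq_iff scaleR_fun_def)
  have \<phi>_add: "\<phi> i (a + b) = \<phi> i a + \<phi> i b" if "a \<in> topspace (X i)" "b \<in> topspace (X i)" for i a b
    using that subspace_add[OF sub that] by (simp add: \<phi>_def single_add linear_add[OF \<Lambda>])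
  have \<phi>_scale: "\<phi> i (c *\<^sub>R a) = c * \<phi> i a" if "a \<in> topspace (X i)" for i a c
    using that subspace_scale[OF sub that] by (simp add: \<phi>_def single_scale linear_scale[OF \<Lambda>])
  have \<phi>_le: "\<phi> i u \<le> 1" if "u \<in> U i" for i u
    using le[of "single i u"] that zero_in_convex_zero_nbhd[OF U]
    by (auto simp: \<phi>_def single_def)
  have "continuous_map (X i) euclideanreal (\<phi> i)" for i
    by (rule linear_bounded_on_nbhd_imp_continuous[OF X U]) (auto simp: \<phi>_add \<phi>_scale \<phi>_le)
  then have dual: "\<phi> i \<in> lcs_dual (X i)" for i
    unfolding lcs_dual_def using \<phi>_add \<phi>_scale by (simp add: \<phi>_def)
  show ?thesis
  proof (rule that[OF dual])
    fix x :: "'m \<Rightarrow> 'a" assume x: "\<And>i. x i \<in> topspace (X i)"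
    have "x = (\<Sum>i\<in>UNIV. single i (x i))"
    proof
      fix j
      have "(\<Sum>i\<in>UNIV. single i (x i)) j = (\<Sum>i\<in>UNIV. single i (x i) j)"
        by (rule sum_fun_apply)
      then show "x j = (\<Sum>i\<in>UNIV. single i (x i)) j"
        by (simp add: single_def)
    qed
    then have "\<Lambda> x = (\<Sum>i\<in>UNIV. \<Lambda> (single i (x i)))"
      using linear_sum[OF \<Lambda>, of "\<lambda>i. single i (x i)" UNIV] by simp
    then show "\<Lambda> x = (\<Sum>i\<in>UNIV. \<phi> i (x i))"
      using x by (simp add: \<phi>_def)
  qed
qed

section \<open>Annihilators and separation in the weak* topology\<close>

text \<open>
  Applied to the values of a functional along a line, this says that a functional bounded below on a
  subspace vanishes on it.
\<close>

lemma affine_bounded_below_imp_constant: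
  fixes b :: real
  assumes "\<And>c. l \<le> c * b + e"
  shows "b = 0"
proof (rule ccontr)
  assume "b \<noteq> 0"
  then show False
    using assms[of "(l - e - 1) / b"] by simp
qed

lemma subspace_lcs_dual:
  assumes X: "separated_lcs X"
  shows "subspace (lcs_dual X)"
proof (rule subspaceI)
  show "0 \<in> lcs_dual X"
    by (auto simp: lcs_dual_def zero_fun_def)
  show "\<phi> + \<psi> \<in> lcs_dual X" if "\<phi> \<in> lcs_dual X" "\<psi> \<in> lcs_dual X" for \<phi> \<psi>
    using that by (auto simp: lcs_dual_def plus_fun_def distrib_left intro: continuous_map_add)
  show "c *\<^sub>R \<phi> \<in> lcs_dual X" if "\<phi> \<in> lcs_dual X" for c \<phi>
    using that by (auto simp: lcs_dual_def scaleR_fun_def distrib_left intro: continuous_map_real_mult_left)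
qed

lemma subspace_annihilator:
  assumes X: "\<And>i. separated_lcs (X i)"
  shows "subspace (annihilator X S)"
  using subspace_lcs_dual[OF X]
  by (intro subspaceI)
     (auto simp: annihilator_def Pi_iff subspace_def scaleR_fun_def sum.distrib sum_distrib_left[symmetric])

lemma lcs_dual_add:
  "\<phi> \<in> lcs_dual X \<Longrightarrow> a \<in> topspace X \<Longrightarrow> b \<in> topspace X \<Longrightarrow> \<phi> (a + b) = \<phi> a + \<phi> b"
  by (simp add: lcs_dual_def)

lemma lcs_dual_scaleR: "\<phi> \<in> lcs_dual X \<Longrightarrow> a \<in> topspace X \<Longrightarrow> \<phi> (c *\<^sub>R a) = c * \<phi> a"
  by (simp add: lcs_dual_def)

lemma lcs_dual_diff:
  assumes X: "separated_lcs X" and \<phi>: "\<phi> \<in> lcs_dual X" and a: "a \<in> topspace X" and b: "b \<in> topspace X"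
  shows "\<phi> (a - b) = \<phi> a - \<phi> b"
proof -
  have "a - b \<in> topspace X"
    using separated_lcs_subspace[OF X] a b by (rule subspace_diff)
  then show ?thesis
    using lcs_dual_add[OF \<phi> _ b, of "a - b"] by simp
qed

lemma lcs_dual_sum:
  assumes X: "separated_lcs X" and \<phi>: "\<phi> \<in> lcs_dual X" and F: "F \<subseteq> topspace X"
  shows "\<phi> (\<Sum>a\<in>F. c a *\<^sub>R a) = (\<Sum>a\<in>F. c a * \<phi> a)"
  using F
proof (induction F rule: infinite_finite_induct)
  case (insert a F)
  have sub: "subspace (topspace X)"
    by (rule separated_lcs_subspace[OF X])
  have "(\<Sum>a\<in>F. c a *\<^sub>R a) \<in> topspace X" "c a *\<^sub>R a \<in> topspace X"
    using insert.prems by (auto intro!: subspace_sum[OF sub] subspace_scale[OF sub])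
  then show ?case
    using insert by (simp add: lcs_dual_add[OF \<phi>] lcs_dual_scaleR[OF \<phi>])
qed (use lcs_dual_scaleR[OF \<phi> subspace_0[OF separated_lcs_subspace[OF X]], of 0] in auto)

lemma convex_absorbing_pullback:
  fixes X :: "'m::finite \<Rightarrow> 'a::real_vector topology"
  assumes X: "\<And>i. separated_lcs (X i)" and U: "\<And>i. convex_zero_nbhd (X i) (U i)"
    and \<pi>: "linear \<pi>" "\<And>v i. \<pi> v i \<in> topspace (X i)"
  shows "convex {v. \<forall>i. \<pi> v i \<in> U i}" "absorbing {v. \<forall>i. \<pi> v i \<in> U i}"
proof -
  have cU: "convex (U i)" for i
    using U[of i] by (simp add: convex_zero_nbhd_def)
  show "convex {v. \<forall>i. \<pi> v i \<in> U i}"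
    using convexD[OF cU] by (auto simp: convex_def linear_add[OF \<pi>(1)] linear_scale[OF \<pi>(1)] scaleR_fun_def)
  show "absorbing {v. \<forall>i. \<pi> v i \<in> U i}"
    unfolding absorbing_def
  proof
    fix v
    obtain t where t: "0 < t" "\<And>s i. 0 \<le> s \<Longrightarrow> s \<le> t \<Longrightarrow> s *\<^sub>R \<pi> v i \<in> U i"
      using product_nbhd_absorbs[of X U "\<pi> v"] X U \<pi>(2) by blast
    then show "\<exists>t>0. t *\<^sub>R v \<in> {v. \<forall>i. \<pi> v i \<in> U i}"
      using t(2)[of t] by (intro exI[of _ t]) (simp add: linear_scale[OF \<pi>(1)] scaleR_fun_def)
  qed
qed

text \<open>
  If \<open>d\<close> is not in \<open>S\<close>, then \<open>S - d\<close> misses a neighbourhood of \<open>0\<close>; a separating functional is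
  bounded below on \<open>S\<close>, hence zero there, and is at most \<open>- 1\<close> at \<open>d\<close>.
\<close>

lemma closed_subspace_bipolar:
  fixes X :: "'m::finite \<Rightarrow> 'a::real_vector topology"
  assumes X: "\<And>i. separated_lcs (X i)"
    and S: "subspace S" "closedin (product_topology X UNIV) S"
    and d: "\<And>i. d i \<in> topspace (X i)"
    and annihilates: "\<And>\<phi>. \<phi> \<in> annihilator X S \<Longrightarrow> (\<Sum>i\<in>UNIV. \<phi> i (d i)) = 0"
  shows "d \<in> S"
proof (rule ccontr)
  assume "d \<notin> S"
  let ?P = "product_topology X UNIV"
  have SP: "s i \<in> topspace (X i)" if "s \<in> S" for s i
    using closedin_subset[OF S(2)] that mem_topspace_product[of s X] by blast
  have op: "openin ?P (topspace ?P - S)"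
    using S(2) by blast
  have "d \<in> topspace ?P - S"
    using d \<open>d \<notin> S\<close> mem_topspace_product[of d X] by blast
  then obtain U where U: "\<And>i. convex_zero_nbhd (X i) (U i)"
    and avoid: "\<And>u. (\<And>i. u i \<in> U i) \<Longrightarrow> d + u \<in> topspace ?P - S"
    using convex_zero_nbhds_translate[OF X op] by blast
  obtain \<pi> where \<pi>: "linear \<pi>" "\<And>v i. \<pi> v i \<in> topspace (X i)"
    "\<And>v. (\<And>i. v i \<in> topspace (X i)) \<Longrightarrow> \<pi> v = v"
    using product_projection[of X] X by blast
  have "convex ((\<lambda>s. s - d) ` S)"
    using convex_translation_subtract[OF subspace_imp_convex[OF S(1)]] .
  moreover have "(\<lambda>s. s - d) ` S \<inter> {v. \<forall>i. \<pi> v i \<in> U i} = {}"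
  proof -
    have False if s: "s \<in> S" "\<forall>i. \<pi> (s - d) i \<in> U i" for s
    proof -
      have "\<pi> (s - d) = s - d"
        using SP[OF s(1)] d subspace_diff[OF separated_lcs_subspace[OF X]] by (intro \<pi>(3)) simp
      then have "d + (s - d) \<in> topspace ?P - S"
        using s(2) by (intro avoid) simp
      then show False
        using s(1) by simp
    qed
    then show ?thesis by auto
  qed
  ultimately obtain \<Lambda> :: "('m \<Rightarrow> 'a) \<Rightarrow> real" where \<Lambda>: "linear \<Lambda>"
    "\<And>u. u \<in> {v. \<forall>i. \<pi> v i \<in> U i} \<Longrightarrow> \<Lambda> u \<le> 1" "\<And>a. a \<in> (\<lambda>s. s - d) ` S \<Longrightarrow> 1 \<le> \<Lambda> a"
    using convex_separation[OF convex_absorbing_pullback[OF X U \<pi>(1,2)]] by blast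
  have "\<Lambda> u \<le> 1" if "\<And>i. u i \<in> U i" for u
  proof (rule \<Lambda>(2))
    have "u i \<in> topspace (X i)" for i
      using that[of i] U[of i] by (auto simp: convex_zero_nbhd_def)
    then show "u \<in> {v. \<forall>i. \<pi> v i \<in> U i}"
      using that \<pi>(3) by simp
  qed
  then obtain \<phi> where \<phi>: "\<And>i. \<phi> i \<in> lcs_dual (X i)"
    "\<And>x. (\<And>i. x i \<in> topspace (X i)) \<Longrightarrow> \<Lambda> x = (\<Sum>i\<in>UNIV. \<phi> i (x i))"
    using product_functional_components[of X U \<Lambda>] X U \<Lambda>(1) by blast
  have bound: "1 \<le> \<Lambda> s - \<Lambda> d" if "s \<in> S" for s
    using \<Lambda>(3)[of "s - d"] that by (auto simp: linear_diff[OF \<Lambda>(1)])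
  have zero: "\<Lambda> s = 0" if "s \<in> S" for s
  proof (rule affine_bounded_below_imp_constant)
    fix c :: real
    have "c *\<^sub>R s \<in> S"
      using S(1) that by (rule subspace_scale)
    then show "1 \<le> c * \<Lambda> s + - \<Lambda> d"
      using bound[of "c *\<^sub>R s"] by (simp add: linear_scale[OF \<Lambda>(1)])
  qed
  have "\<phi> \<in> annihilator X S"
    using \<phi> zero SP by (fastforce simp: annihilator_def)
  then have "\<Lambda> d = 0"
    using annihilates \<phi>(2)[of d] d by simp
  then show False
    using bound[OF subspace_0[OF S(1)]] linear_0[OF \<Lambda>(1)] by simp
qed

lemma weak_star_zero_nbhd:
  assumes V: "openin (weak_star X) V" "0 \<in> V"
  obtains F e where "finite F" "\<And>a. 0 < e a"
    "\<And>\<phi>. \<phi> \<in> lcs_dual X \<Longrightarrow> (\<And>a. a \<in> F \<Longrightarrow> \<bar>\<phi> a\<bar> < e a) \<Longrightarrow> \<phi> \<in> V"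
proof -
  obtain W where W: "openin (product_topology (\<lambda>_. euclideanreal) UNIV) W" "V = W \<inter> lcs_dual X"
    using V(1) unfolding weak_star_def openin_subtopology by blast
  have "0 \<in> W"
    using V(2) W(2) by blast
  then obtain N where N: "finite {a \<in> UNIV. N a \<noteq> topspace euclideanreal}"
    "\<forall>a\<in>UNIV. openin euclideanreal (N a)" "0 \<in> Pi\<^sub>E UNIV N" "Pi\<^sub>E UNIV N \<subseteq> W"
    using W(1) unfolding openin_product_topology_alt by blast
  have "\<exists>e>0. ball 0 e \<subseteq> N a" for a
  proof -
    have "open (N a)" "0 \<in> N a"
      using N(2,3) by (auto simp: PiE_iff)
    then show ?thesis
      using open_contains_ball by blast
  qed
  then obtain e where e: "\<And>a. 0 < e a" "\<And>a. ball 0 (e a) \<subseteq> N a"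
    by metis
  show ?thesis
  proof (rule that[of "{a. N a \<noteq> UNIV}" e])
    fix \<phi> assume \<phi>: "\<phi> \<in> lcs_dual X" "\<And>a. a \<in> {a. N a \<noteq> UNIV} \<Longrightarrow> \<bar>\<phi> a\<bar> < e a"
    have "\<phi> a \<in> N a" for a
      using \<phi>(2)[of a] e(2)[of a] by (cases "N a = UNIV") auto
    then show "\<phi> \<in> V"
      using N(4) W(2) \<phi>(1) by (auto simp: PiE_iff)
  qed (use N(1) e(1) in auto)
qed

text \<open>
  The dual of the weak\<open>*\<close> topology consists of the evaluations at points. A functional that is bounded
  by \<open>1\<close> on the set \<open>U\<close> of all \<open>\<phi>\<close> that are small at finitely many points depends only on the
  values of \<open>\<phi>\<close> at these points, so it is a finite combination of evaluations, and \<open>d\<close> is the same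
  combination of the points.
\<close>

lemma weak_star_separation:
  fixes X :: "'m::finite \<Rightarrow> 'a::real_vector topology"
  assumes X: "\<And>i. separated_lcs (X i)"
    and C: "convex C" "closedin (product_topology (\<lambda>i. weak_star (X i)) UNIV) C" "0 \<notin> C"
  obtains d where "\<And>i. d i \<in> topspace (X i)" "\<And>\<phi>. \<phi> \<in> C \<Longrightarrow> 1 \<le> (\<Sum>i\<in>UNIV. \<phi> i (d i))"
proof -
  let ?D = "product_topology (\<lambda>i. weak_star (X i)) UNIV"
  have top: "topspace (weak_star (X i)) = lcs_dual (X i)" for i
    by (auto simp: weak_star_def)
  have dual: "\<phi> i \<in> lcs_dual (X i)" if "\<phi> \<in> C" for \<phi> i
    using closedin_subset[OF C(2)] that mem_topspace_product[of \<phi> "\<lambda>i. weak_star (X i)"] top by blast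
  have "0 \<in> topspace ?D - C"
    using C(3) subspace_0[OF subspace_lcs_dual[OF X]]
    by (simp add: mem_topspace_product top del: topspace_product_topology)
  moreover have "openin ?D (topspace ?D - C)"
    using C(2) by blast
  ultimately have "\<exists>V. finite {i \<in> UNIV. V i \<noteq> topspace (weak_star (X i))} \<and>
      (\<forall>i\<in>UNIV. openin (weak_star (X i)) (V i)) \<and> 0 \<in> Pi\<^sub>E UNIV V \<and>
      Pi\<^sub>E UNIV V \<subseteq> topspace ?D - C"
    by (simp only: openin_product_topology_alt)
  then obtain V where V: "\<And>i. openin (weak_star (X i)) (V i)" "0 \<in> Pi\<^sub>E UNIV V"
      "Pi\<^sub>E UNIV V \<subseteq> topspace ?D - C"
    by blast
  have "\<exists>F e. finite F \<and> (\<forall>a. 0 < e a) \<and>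
      (\<forall>\<phi>\<in>lcs_dual (X i). (\<forall>a\<in>F. \<bar>\<phi> a\<bar> < e a) \<longrightarrow> \<phi> \<in> V i)" for i
  proof -
    have "0 \<in> V i"
      using V(2) by (auto simp: PiE_iff)
    then obtain F e where "finite F" "\<And>a. 0 < e a"
      "\<And>\<phi>. \<phi> \<in> lcs_dual (X i) \<Longrightarrow> (\<And>a. a \<in> F \<Longrightarrow> \<bar>\<phi> a\<bar> < e a) \<Longrightarrow> \<phi> \<in> V i"
      using weak_star_zero_nbhd[OF V(1)] by blast
    then show ?thesis
      by (intro exI[of _ F] exI[of _ e]) simp
  qed
  then obtain F e where F: "\<And>i. finite (F i)" and e: "\<And>i a. 0 < e i a"
    and FV: "\<And>i \<phi>. \<phi> \<in> lcs_dual (X i) \<Longrightarrow> (\<forall>a\<in>F i. \<bar>\<phi> a\<bar> < e i a) \<Longrightarrow> \<phi> \<in> V i"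
    by metis
  define U :: "('m \<Rightarrow> 'a \<Rightarrow> real) set" where "U = {\<phi>. \<forall>i. \<forall>a\<in>F i. \<bar>\<phi> i a\<bar> < e i a}"
  have "\<bar>r\<bar> < s \<longleftrightarrow> r \<in> {- s<..<s}" for r s :: real
    by auto
  then have U_eq: "U = {\<phi>. \<forall>i. \<forall>a\<in>F i. \<phi> i a \<in> {- e i a<..<e i a}}"
    by (simp only: U_def)
  have "convex U"
  proof (rule convexI)
    fix \<phi> \<psi> :: "'m \<Rightarrow> 'a \<Rightarrow> real" and u v :: real
    assume *: "\<phi> \<in> U" "\<psi> \<in> U" "0 \<le> u" "0 \<le> v" "u + v = 1"
    have "u *\<^sub>R \<phi> i a + v *\<^sub>R \<psi> i a \<in> {- e i a<..<e i a}" if "a \<in> F i" for i a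
      using * that unfolding U_eq by (intro convexD[OF convex_real_interval(8)]) blast+
    then show "u *\<^sub>R \<phi> + v *\<^sub>R \<psi> \<in> U"
      unfolding U_eq by (simp add: scaleR_fun_def del: greaterThanLessThan_iff)
  qed
  have "absorbing U"
    unfolding absorbing_def
  proof
    fix \<phi> :: "'m \<Rightarrow> 'a \<Rightarrow> real"
    \<comment> \<open>The factor 1 / (1 + s) brings all finitely many ratios below 1 at once.\<close>
    define s where "s = (\<Sum>i\<in>UNIV. \<Sum>a\<in>F i. \<bar>\<phi> i a\<bar> / e i a)"
    have pos: "0 \<le> \<bar>\<phi> i a\<bar> / e i a" for i a
      using e[of i a] by simp
    have s0: "0 \<le> s"
      unfolding s_def by (intro sum_nonneg pos)
    have le: "\<bar>\<phi> i a\<bar> / e i a \<le> s" if "a \<in> F i" for i a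
    proof -
      have "\<bar>\<phi> i a\<bar> / e i a \<le> (\<Sum>a\<in>F i. \<bar>\<phi> i a\<bar> / e i a)"
        using that F pos by (intro member_le_sum) auto
      also have "\<dots> \<le> s"
        unfolding s_def using pos
        by (intro member_le_sum[of i UNIV "\<lambda>i. \<Sum>a\<in>F i. \<bar>\<phi> i a\<bar> / e i a"]) (auto intro: sum_nonneg)
      finally show ?thesis .
    qed
    have "\<bar>\<phi> i a\<bar> / (1 + s) < e i a" if "a \<in> F i" for i a
      using le[OF that] e[of i a] s0 by (simp add: field_simps)
    then have "(1 / (1 + s)) *\<^sub>R \<phi> \<in> U"
      using s0 by (simp add: U_def scaleR_fun_def abs_mult)
    then show "\<exists>t>0. t *\<^sub>R \<phi> \<in> U"
      using s0 by (intro exI[of _ "1 / (1 + s)"]) simp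
  qed
  have "C \<inter> U = {}"
  proof -
    have "\<phi> \<notin> U" if "\<phi> \<in> C" for \<phi>
    proof
      assume "\<phi> \<in> U"
      then have "\<phi> \<in> Pi\<^sub>E UNIV V"
        using FV dual[OF that] by (simp add: U_def PiE_iff)
      then show False
        using V(3) that by blast
    qed
    then show ?thesis by blast
  qed
  then obtain \<Lambda> :: "('m \<Rightarrow> 'a \<Rightarrow> real) \<Rightarrow> real" where \<Lambda>: "linear \<Lambda>"
    "\<And>u. u \<in> U \<Longrightarrow> \<Lambda> u \<le> 1" "\<And>\<phi>. \<phi> \<in> C \<Longrightarrow> 1 \<le> \<Lambda> \<phi>"
    using convex_separation[OF \<open>convex U\<close> \<open>absorbing U\<close> C(1)] by blast
  define unit :: "'m \<Rightarrow> 'a \<Rightarrow> 'm \<Rightarrow> 'a \<Rightarrow> real"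
    where "unit i a = (\<lambda>j b. if j = i \<and> b = a then 1 else 0)" for i a
  have rep: "\<Lambda> \<phi> = (\<Sum>i\<in>UNIV. \<Sum>a\<in>F i. \<phi> i a * \<Lambda> (unit i a))" for \<phi>
  proof -
    \<comment> \<open>The difference of \<sigma> and \<phi> vanishes at all points that define U, so U contains all multiples of it.\<close>
    define \<sigma> where "\<sigma> = (\<Sum>i\<in>UNIV. \<Sum>a\<in>F i. \<phi> i a *\<^sub>R unit i a)"
    have "\<sigma> j b = \<phi> j b" if "b \<in> F j" for j b
    proof -
      have "\<sigma> j b = (\<Sum>i\<in>UNIV. \<Sum>a\<in>F i. \<phi> i a * unit i a j b)"
        by (simp add: \<sigma>_def sum_fun_apply scaleR_fun_def)
      also have "\<dots> = (\<Sum>i\<in>UNIV. if i = j then \<phi> j b else 0)"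
      proof (rule sum.cong[OF refl])
        fix i
        have "(\<Sum>a\<in>F i. \<phi> i a * unit i a j b) = (\<Sum>a\<in>F i. if a = b then (if i = j then \<phi> j b else 0) else 0)"
          by (rule sum.cong) (auto simp: unit_def)
        also have "\<dots> = (if i = j then \<phi> j b else 0)"
          using F[of i] that by simp
        finally show "(\<Sum>a\<in>F i. \<phi> i a * unit i a j b) = (if i = j then \<phi> j b else 0)" .
      qed
      also have "\<dots> = \<phi> j b"
        by simp
      finally show ?thesis .
    qed
    then have "c *\<^sub>R (\<sigma> - \<phi>) \<in> U" for c
      using e by (simp add: U_def scaleR_fun_def)
    then have "c * (\<Lambda> \<sigma> - \<Lambda> \<phi>) \<le> 1" for c
      using \<Lambda>(2)[of "c *\<^sub>R (\<sigma> - \<phi>)"] by (simp add: linear_scale[OF \<Lambda>(1)] linear_diff[OF \<Lambda>(1)])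
    then have "- 1 \<le> c * (\<Lambda> \<sigma> - \<Lambda> \<phi>) + 0" for c
      by (metis add.right_neutral minus_le_iff mult_minus_left minus_minus)
    then have "\<Lambda> \<phi> = \<Lambda> \<sigma>"
      using affine_bounded_below_imp_constant[of "- 1" "\<Lambda> \<sigma> - \<Lambda> \<phi>" 0] by simp
    also have "\<dots> = (\<Sum>i\<in>UNIV. \<Sum>a\<in>F i. \<phi> i a * \<Lambda> (unit i a))"
      by (simp add: \<sigma>_def linear_sum[OF \<Lambda>(1)] linear_scale[OF \<Lambda>(1)])
    finally show ?thesis .
  qed
  \<comment> \<open>The points of F i outside the carrier can be dropped, as the dual functionals vanish there.\<close>
  define d where "d i = (\<Sum>a\<in>F i \<inter> topspace (X i). \<Lambda> (unit i a) *\<^sub>R a)" for i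
  show ?thesis
  proof (rule that)
    show "d i \<in> topspace (X i)" for i
      using separated_lcs_subspace[OF X, of i] unfolding d_def
      by (intro subspace_sum subspace_scale) auto
    fix \<phi> assume \<phi>: "\<phi> \<in> C"
    have "\<phi> i (d i) = (\<Sum>a\<in>F i. \<phi> i a * \<Lambda> (unit i a))" for i
    proof -
      have "\<phi> i (d i) = (\<Sum>a\<in>F i \<inter> topspace (X i). \<Lambda> (unit i a) * \<phi> i a)"
        unfolding d_def by (rule lcs_dual_sum[OF X dual[OF \<phi>]]) simp
      also have "\<dots> = (\<Sum>a\<in>F i. \<phi> i a * \<Lambda> (unit i a))"
        using dual[OF \<phi>, of i] F[of i]
        by (intro sum.mono_neutral_cong_left) (auto simp: lcs_dual_def)
      finally show ?thesis .
    qed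
    then show "1 \<le> (\<Sum>i\<in>UNIV. \<phi> i (d i))"
      using \<Lambda>(3)[OF \<phi>] by (simp add: rep[of \<phi>])
  qed
qed

section \<open>Approximate subgradients along a segment\<close>

text \<open>
  The segment is compact, so by the tube lemma one neighbourhood serves for all of its points.
\<close>

lemma segment_tube:
  fixes X :: "'m::finite \<Rightarrow> 'a::real_vector topology"
  assumes X: "\<And>i. separated_lcs (X i)"
    and E: "closedin (prod_topology (product_topology X UNIV) euclideanreal) E"
    and x: "\<And>i. x i \<in> topspace (X i)" and d: "\<And>i. d i \<in> topspace (X i)"
    and segment: "\<And>t. \<bar>t\<bar> \<le> T \<Longrightarrow> (x + t *\<^sub>R d, \<rho>) \<notin> E"
  obtains U \<eta> where "\<And>i. convex_zero_nbhd (X i) (U i)" "0 < \<eta>"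
    "\<And>t u r. \<bar>t\<bar> \<le> T \<Longrightarrow> (\<And>i. u i \<in> U i) \<Longrightarrow> \<bar>r\<bar> < \<eta> \<Longrightarrow> (x + t *\<^sub>R d + u, \<rho> + r) \<notin> E"
proof -
  let ?P = "product_topology X UNIV"
  let ?M = "prod_topology ?P euclideanreal"
  let ?D = "prod_topology euclideanreal ?M"
  let ?F = "\<lambda>z. (x + fst z *\<^sub>R d + fst (snd z), \<rho> + snd (snd z))"
  have cont_fst: "continuous_map ?D euclideanreal fst"
    by (rule continuous_map_fst)
  have cont_u: "continuous_map ?D ?P (\<lambda>z. fst (snd z))"
    using continuous_map_compose[OF continuous_map_snd continuous_map_fst] by (simp add: o_def)
  have cont_r: "continuous_map ?D euclideanreal (\<lambda>z. snd (snd z))"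
    using continuous_map_compose[OF continuous_map_snd continuous_map_snd] by (simp add: o_def)
  have cont_ui: "continuous_map ?D (X i) (\<lambda>z. fst (snd z) i)" for i
    using cont_u by (simp add: continuous_map_componentwise_UNIV)
  have "continuous_map ?D (X i) (\<lambda>z. (x + fst z *\<^sub>R d + fst (snd z)) i)" for i
    unfolding plus_fun_def scaleR_fun_def
    by (intro separated_lcs_continuous_add X separated_lcs_continuous_scaleR cont_ui cont_fst)
       (use x d in auto)
  then have "continuous_map ?D ?P (\<lambda>z. x + fst z *\<^sub>R d + fst (snd z))"
    by (simp add: continuous_map_componentwise_UNIV)
  moreover have "continuous_map ?D euclideanreal (\<lambda>z. \<rho> + snd (snd z))"
    by (intro continuous_map_add cont_r) auto
  ultimately have cont: "continuous_map ?D ?M ?F"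
    by (rule continuous_map_pairedI)
  let ?W = "{z \<in> topspace ?D. ?F z \<in> topspace ?M - E}"
  have "openin ?M (topspace ?M - E)"
    using E by blast
  then have W: "openin ?D ?W"
    by (rule openin_continuous_map_preimage[OF cont])
  have zero: "(0, 0) \<in> topspace ?M"
    using subspace_0[OF separated_lcs_subspace[OF X]]
    by (simp add: mem_topspace_product del: topspace_product_topology)
  have "{- T..T} \<times> {(0, 0)} \<subseteq> ?W"
  proof
    fix z :: "real \<times> ('m \<Rightarrow> 'a) \<times> real" assume "z \<in> {- T..T} \<times> {(0, 0)}"
    then obtain t where t: "z = (t, 0, 0)" "\<bar>t\<bar> \<le> T"
      by auto
    have zD: "z \<in> topspace ?D"
      using zero t(1) by simp
    have "?F z \<in> topspace ?M"
      using continuous_map_image_subset_topspace[OF cont] zD by blast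
    moreover have "?F z \<notin> E"
      using segment[OF t(2)] t(1) by simp
    ultimately show "z \<in> ?W"
      using zD by blast
  qed
  then obtain T' V where V: "openin ?M V" "{- T..T} \<subseteq> T'" "(0, 0) \<in> V" "T' \<times> V \<subseteq> ?W"
    using tube_lemma_left[OF W _ zero, of "{- T..T}"] by auto
  obtain O1 O2 where O: "openin ?P O1" "openin euclideanreal O2" "0 \<in> O1" "0 \<in> O2" "O1 \<times> O2 \<subseteq> V"
    using V(1,3) unfolding openin_prod_topology_alt by metis
  obtain U where U: "\<And>i. convex_zero_nbhd (X i) (U i)" "\<And>u. (\<And>i. u i \<in> U i) \<Longrightarrow> 0 + u \<in> O1"
    using convex_zero_nbhds_translate[OF X O(1,3)] by blast
  have "open O2"
    using O(2) by simp
  then obtain \<eta> where \<eta>: "0 < \<eta>" "ball 0 \<eta> \<subseteq> O2"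
    using O(4) open_contains_ball by blast
  show ?thesis
  proof (rule that[OF U(1) \<eta>(1)])
    fix t u and r :: real
    assume tur: "\<bar>t\<bar> \<le> T" "\<And>i. u i \<in> U i" "\<bar>r\<bar> < \<eta>"
    have "u \<in> O1" "r \<in> O2"
      using U(2)[of u] tur(2,3) \<eta>(2) by auto
    then have "(u, r) \<in> V"
      using O(5) by blast
    moreover have "t \<in> {- T..T}"
      using tur(1) by auto
    ultimately have "(t, u, r) \<in> ?W"
      using V(2,4) by blast
    then show "(x + t *\<^sub>R d + u, \<rho> + r) \<notin> E"
      by simp
  qed
qed

text \<open>
  The epigraph is separated from a convex neighbourhood of the segment of points
  \<open>(x + t d, \<gamma> - \<epsilon>)\<close> with \<open>\<bar>t\<bar> \<le> T\<close>. The point \<open>(x, \<gamma>)\<close> of the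
  epigraph lies at height \<open>\<epsilon>\<close> above the segment, hence the coefficient \<open>\<alpha>\<close> of the real
  coordinate in the separating functional \<open>\<Lambda>\<close> satisfies \<open>\<epsilon> \<alpha> \<ge> 1\<close>. Dividing by \<open>- \<alpha>\<close> gives an \<open>\<epsilon>\<close>-subgradient; and the bound of \<open>\<Lambda>\<close> by \<open>1\<close> at both
  ends \<open>(\<plusminus> T d, 0)\<close> makes it small at \<open>d\<close>.
\<close>

lemma eps_subgradient_small_along_segment:
  fixes X :: "'m::finite \<Rightarrow> 'a::real_vector topology" and g :: "('m \<Rightarrow> 'a) \<Rightarrow> ereal"
  defines "P \<equiv> product_topology X UNIV"
  assumes X: "\<And>i. separated_lcs (X i)"
    and g: "convex (ereal_epigraph P g)"
    and x: "\<And>i. x i \<in> topspace (X i)" "g x = ereal \<gamma>" and d: "\<And>i. d i \<in> topspace (X i)"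
    and pos: "0 < \<epsilon>" "0 < T"
    and segment: "\<And>t. \<bar>t\<bar> \<le> T \<Longrightarrow>
      (x + t *\<^sub>R d, \<gamma> - \<epsilon>) \<notin> prod_topology P euclideanreal closure_of ereal_epigraph P g"
  obtains \<phi> where "\<And>i. \<phi> i \<in> lcs_dual (X i)"
    "\<And>y. (\<And>i. y i \<in> topspace (X i)) \<Longrightarrow> ereal (\<gamma> + (\<Sum>i\<in>UNIV. \<phi> i (y i - x i)) - \<epsilon>) \<le> g y"
    "\<bar>\<Sum>i\<in>UNIV. \<phi> i (d i)\<bar> \<le> \<epsilon> / T"
proof -
  let ?E = "prod_topology P euclideanreal closure_of ereal_epigraph P g"
  have sub: "subspace (topspace (X i))" for i
    by (rule separated_lcs_subspace[OF X])
  have memP: "y \<in> topspace P \<longleftrightarrow> (\<forall>i. y i \<in> topspace (X i))" for y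
    unfolding P_def by (rule mem_topspace_product)
  have epi_E: "ereal_epigraph P g \<subseteq> ?E"
    by (rule closure_of_subset) (auto simp: ereal_epigraph_def)
  have "closedin (prod_topology (product_topology X UNIV) euclideanreal) ?E"
    unfolding P_def by (rule closedin_closure_of)
  then obtain U \<eta> where U: "\<And>i. convex_zero_nbhd (X i) (U i)" and \<eta>: "0 < \<eta>"
    and tube: "\<And>t u r. \<bar>t\<bar> \<le> T \<Longrightarrow> (\<And>i. u i \<in> U i) \<Longrightarrow> \<bar>r\<bar> < \<eta> \<Longrightarrow>
      (x + t *\<^sub>R d + u, (\<gamma> - \<epsilon>) + r) \<notin> ?E"
    using segment_tube[of X ?E x d T "\<gamma> - \<epsilon>"] X x(1) d segment by blast
  obtain \<pi> where \<pi>: "linear \<pi>" "\<And>v i. \<pi> v i \<in> topspace (X i)"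
    "\<And>v. (\<And>i. v i \<in> topspace (X i)) \<Longrightarrow> \<pi> v = v"
    using product_projection[of X] X by blast
  let ?U = "{v. \<forall>i. \<pi> v i \<in> U i}"
  note pullback = convex_absorbing_pullback[OF X U \<pi>(1,2)]
  \<comment> \<open>Both sets are translated so that the point of the segment with t = 0 becomes the origin.\<close>
  define B where "B = {(v, r). \<exists>t. \<bar>t\<bar> \<le> T \<and> v - t *\<^sub>R d \<in> ?U \<and> \<bar>r\<bar> < \<eta>}"
  define A where "A = (\<lambda>p. p - (x, \<gamma> - \<epsilon>)) ` ereal_epigraph P g"
  have inB: "(t *\<^sub>R d + u, r) \<in> B" if "\<bar>t\<bar> \<le> T" "u \<in> ?U" "\<bar>r\<bar> < \<eta>" for t u r
    unfolding B_def using that by (intro CollectI case_prodI exI[of _ t]) simp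
  have "convex B"
  proof (rule convexI)
    fix p q and a b :: real assume *: "p \<in> B" "q \<in> B" "0 \<le> a" "0 \<le> b" "a + b = 1"
    obtain v r t where p: "p = (v, r)" "\<bar>t\<bar> \<le> T" "v - t *\<^sub>R d \<in> ?U" "\<bar>r\<bar> < \<eta>"
      using *(1) by (auto simp: B_def)
    obtain w s u where q: "q = (w, s)" "\<bar>u\<bar> \<le> T" "w - u *\<^sub>R d \<in> ?U" "\<bar>s\<bar> < \<eta>"
      using *(2) by (auto simp: B_def)
    have "a *\<^sub>R (v - t *\<^sub>R d) + b *\<^sub>R (w - u *\<^sub>R d) \<in> ?U"
      using * p q by (intro convexD[OF pullback(1)]) auto
    moreover have "a *\<^sub>R t + b *\<^sub>R u \<in> {- T..T}"
      using * p(2) q(2) by (intro convexD[OF convex_real_interval(5)]) auto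
    moreover have "a *\<^sub>R r + b *\<^sub>R s \<in> {- \<eta><..<\<eta>}"
      using * p(4) q(4) by (intro convexD[OF convex_real_interval(8)]) auto
    ultimately have "((a * t + b * u) *\<^sub>R d + (a *\<^sub>R (v - t *\<^sub>R d) + b *\<^sub>R (w - u *\<^sub>R d)), a * r + b * s) \<in> B"
      by (intro inB) auto
    then show "a *\<^sub>R p + b *\<^sub>R q \<in> B"
      using p(1) q(1) by (simp add: scaleR_add_left scaleR_diff_right algebra_simps)
  qed
  moreover have "absorbing B"
    unfolding absorbing_def
  proof
    fix p :: "('m \<Rightarrow> 'a) \<times> real"
    obtain v r where p: "p = (v, r)" by (cases p)
    obtain t where t: "0 < t" "t *\<^sub>R v \<in> ?U"
      using pullback(2) by (auto simp: absorbing_def)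
    define s where "s = min t (\<eta> / (1 + \<bar>r\<bar>))"
    have "0 < 1 + \<bar>r\<bar>"
      by simp
    moreover have "s \<le> \<eta> / (1 + \<bar>r\<bar>)"
      by (simp add: s_def)
    ultimately have "s * (1 + \<bar>r\<bar>) \<le> \<eta>"
      by (simp only: pos_le_divide_eq)
    moreover have "0 < s" "s \<le> t"
      using t(1) \<eta> \<open>0 < 1 + \<bar>r\<bar>\<close> by (auto simp: s_def)
    ultimately have s: "0 < s" "s \<le> t" "s * (1 + \<bar>r\<bar>) \<le> \<eta>"
      by auto
    have "(s / t) *\<^sub>R (t *\<^sub>R v) + (1 - s / t) *\<^sub>R 0 \<in> ?U"
      using s t absorbing_zero_mem[OF pullback(2)] by (intro convexD[OF pullback(1)]) auto
    then have "s *\<^sub>R v \<in> ?U"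
      using t(1) by simp
    moreover have "\<bar>s * r\<bar> < \<eta>"
      using s by (simp add: abs_mult distrib_left)
    ultimately have "s *\<^sub>R p \<in> B"
      using inB[of 0 "s *\<^sub>R v" "s * r"] pos(2) p by simp
    then show "\<exists>t>0. t *\<^sub>R p \<in> B"
      using s(1) by blast
  qed
  moreover have "convex A"
    unfolding A_def using convex_translation_subtract[OF g] .
  moreover have "A \<inter> B = {}"
  proof -
    have False if yr: "(y, r) \<in> ereal_epigraph P g" and B: "(y, r) - (x, \<gamma> - \<epsilon>) \<in> B" for y r
    proof -
      obtain t where t: "\<bar>t\<bar> \<le> T" "y - x - t *\<^sub>R d \<in> ?U" "\<bar>r - (\<gamma> - \<epsilon>)\<bar> < \<eta>"
        using B by (auto simp: B_def)
      have y: "y i \<in> topspace (X i)" for i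
        using yr memP by (auto simp: ereal_epigraph_def)
      have "\<pi> (y - x - t *\<^sub>R d) = y - x - t *\<^sub>R d"
        using y x(1) d by (intro \<pi>(3)) (simp add: scaleR_fun_def subspace_diff[OF sub] subspace_scale[OF sub])
      then have "(x + t *\<^sub>R d + (y - x - t *\<^sub>R d), (\<gamma> - \<epsilon>) + (r - (\<gamma> - \<epsilon>))) \<notin> ?E"
        using t by (intro tube) auto
      then show False
        using yr epi_E by auto
    qed
    then show ?thesis
      by (auto simp: A_def)
  qed
  ultimately obtain \<Lambda> :: "('m \<Rightarrow> 'a) \<times> real \<Rightarrow> real" where \<Lambda>: "linear \<Lambda>"
    "\<And>p. p \<in> B \<Longrightarrow> \<Lambda> p \<le> 1" "\<And>p. p \<in> A \<Longrightarrow> 1 \<le> \<Lambda> p"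
    using convex_separation[of B A] by blast
  define \<alpha> where "\<alpha> = \<Lambda> (0, 1)"
  have split: "\<Lambda> (v, r) = \<Lambda> (v, 0) + r * \<alpha>" for v r
  proof -
    have "(v, r) = (v, 0) + r *\<^sub>R (0, 1)" by simp
    then show ?thesis
      by (metis \<alpha>_def linear_add[OF \<Lambda>(1)] linear_scale[OF \<Lambda>(1)] real_scaleR_def)
  qed
  have lin: "linear (\<lambda>v. \<Lambda> (v, 0))"
  proof (rule linearI)
    fix v w show "\<Lambda> (v + w, 0) = \<Lambda> (v, 0) + \<Lambda> (w, 0)"
      using linear_add[OF \<Lambda>(1), of "(v, 0)" "(w, 0)"] by simp
  next
    fix c v show "\<Lambda> (c *\<^sub>R v, 0) = c *\<^sub>R \<Lambda> (v, 0)"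
      using linear_scale[OF \<Lambda>(1), of c "(v, 0)"] by simp
  qed
  have "\<Lambda> (u, 0) \<le> 1" if "\<And>i. u i \<in> U i" for u
  proof -
    have "u i \<in> topspace (X i)" for i
      using that[of i] U[of i] by (auto simp: convex_zero_nbhd_def)
    then have "\<pi> u = u"
      by (rule \<pi>(3))
    then show ?thesis
      using that \<Lambda>(2)[OF inB[of 0 u 0]] pos(2) \<eta> by simp
  qed
  then obtain \<psi> where \<psi>: "\<And>i. \<psi> i \<in> lcs_dual (X i)"
    "\<And>v. (\<And>i. v i \<in> topspace (X i)) \<Longrightarrow> \<Lambda> (v, 0) = (\<Sum>i\<in>UNIV. \<psi> i (v i))"
    using product_functional_components[of X U "\<lambda>v. \<Lambda> (v, 0)"] X U lin by blast
  have epi_bound: "1 \<le> \<Lambda> (y - x, 0) + (r - (\<gamma> - \<epsilon>)) * \<alpha>" if "(y, r) \<in> ereal_epigraph P g" for y r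
  proof -
    have "(y - x, r - (\<gamma> - \<epsilon>)) \<in> A"
      unfolding A_def using that by force
    then show ?thesis
      using \<Lambda>(3) split by metis
  qed
  have "(x, \<gamma>) \<in> ereal_epigraph P g"
    using x memP by (auto simp: ereal_epigraph_def)
  from epi_bound[OF this] have \<alpha>_ge: "1 \<le> \<epsilon> * \<alpha>"
    using linear_0[OF lin] by simp
  then have \<alpha>: "0 < \<alpha>"
    using pos(1) by (metis less_le_trans zero_less_mult_pos zero_less_one)
  have "\<Lambda> (t *\<^sub>R d, 0) \<le> 1" if "\<bar>t\<bar> \<le> T" for t
    using \<Lambda>(2)[OF inB[of t 0 0]] that absorbing_zero_mem[OF pullback(2)] \<eta> by simp
  from this[of T] this[of "- T"] have \<Lambda>_d: "T * \<bar>\<Lambda> (d, 0)\<bar> \<le> 1"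
    using pos(2) linear_scale[OF lin, of T d] linear_scale[OF lin, of "- T" d] by (simp add: abs_if)
  define \<phi> where "\<phi> i = (- 1 / \<alpha>) *\<^sub>R \<psi> i" for i
  have sum_\<phi>: "(\<Sum>i\<in>UNIV. \<phi> i (v i)) = - \<Lambda> (v, 0) / \<alpha>" if "\<And>i. v i \<in> topspace (X i)" for v
    using \<psi>(2)[OF that] by (simp add: \<phi>_def scaleR_fun_def sum_negf sum_divide_distrib)
  show ?thesis
  proof (rule that)
    show "\<phi> i \<in> lcs_dual (X i)" for i
      unfolding \<phi>_def by (rule subspace_scale[OF subspace_lcs_dual[OF X] \<psi>(1)])
    have "\<bar>\<Lambda> (d, 0)\<bar> / \<alpha> \<le> \<epsilon> / T"
    proof -
      have "T * \<bar>\<Lambda> (d, 0)\<bar> \<le> \<epsilon> * \<alpha>"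
        using \<Lambda>_d \<alpha>_ge by simp
      then show ?thesis
        using \<alpha> pos(2) by (simp add: field_simps)
    qed
    then show "\<bar>\<Sum>i\<in>UNIV. \<phi> i (d i)\<bar> \<le> \<epsilon> / T"
      using sum_\<phi>[of d] d \<alpha> by simp
    fix y assume y: "\<And>i. y i \<in> topspace (X i)"
    show "ereal (\<gamma> + (\<Sum>i\<in>UNIV. \<phi> i (y i - x i)) - \<epsilon>) \<le> g y"
    proof (rule ereal_le_real)
      fix r assume "g y \<le> ereal r"
      then have "(y, r) \<in> ereal_epigraph P g"
        using y memP by (auto simp: ereal_epigraph_def)
      from epi_bound[OF this] have "- \<Lambda> (y - x, 0) \<le> (r - (\<gamma> - \<epsilon>)) * \<alpha>"
        by simp
      then have "- \<Lambda> (y - x, 0) / \<alpha> \<le> r - (\<gamma> - \<epsilon>)"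
        using \<alpha> by (simp only: pos_divide_le_eq)
      moreover have "(\<Sum>i\<in>UNIV. \<phi> i (y i - x i)) = - \<Lambda> (y - x, 0) / \<alpha>"
        using sum_\<phi>[of "y - x"] y x(1) subspace_diff[OF sub] by simp
      ultimately show "ereal (\<gamma> + (\<Sum>i\<in>UNIV. \<phi> i (y i - x i)) - \<epsilon>) \<le> ereal r"
        by simp
    qed
  qed
qed

section \<open>Approximate subgradients of separable sums\<close>

lemma ereal_sum_finite_imp_real:
  fixes h :: "'m::finite \<Rightarrow> ereal"
  assumes "\<And>i. h i > - \<infinity>" and "(\<Sum>i\<in>UNIV. h i) < \<infinity>"
  obtains a where "\<And>i. h i = ereal (a i)"
proof (rule that)
  fix i
  have "h i \<noteq> \<infinity>"
    using assms(2) sum_Pinfty[of h UNIV] by auto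
  then show "h i = ereal (real_of_ereal (h i))"
    using assms(1)[of i] by (cases "h i") auto
qed

text \<open>
  A point of the epigraph of the sum has real component values: none is \<open>- \<infinity>\<close>, so none can be \<open>\<infinity>\<close>.
\<close>

lemma convex_separable_sum:
  fixes X :: "'m::finite \<Rightarrow> 'a::real_vector topology"
  assumes X: "\<And>i. separated_lcs (X i)"
    and f: "\<And>i. proper_function (X i) (f i)" "\<And>i. convex_function (X i) (f i)"
    and g: "\<And>x. x \<in> topspace (product_topology X UNIV) \<Longrightarrow> g x = (\<Sum>i\<in>UNIV. f i (x i))"
  shows "convex (ereal_epigraph (product_topology X UNIV) g)"
proof (rule convexI)
  let ?P = "product_topology X UNIV"
  have real_values: "\<exists>a. (\<forall>i. y i \<in> topspace (X i) \<and> f i (y i) = ereal (a i)) \<and> (\<Sum>i\<in>UNIV. a i) \<le> r"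
    if yr: "(y, r) \<in> ereal_epigraph ?P g" for y r
  proof -
    have yP: "y \<in> topspace ?P" and le: "g y \<le> ereal r"
      using yr unfolding ereal_epigraph_def by auto
    then have y: "\<And>i. y i \<in> topspace (X i)"
      by (simp only: mem_topspace_product)
    have "(\<Sum>i\<in>UNIV. f i (y i)) < \<infinity>"
      using le g[OF yP] by auto
    moreover have "f i (y i) > - \<infinity>" for i
      using f(1)[of i] y[of i] by (simp add: proper_function_def)
    ultimately obtain a where a: "\<And>i. f i (y i) = ereal (a i)"
      using ereal_sum_finite_imp_real[of "\<lambda>i. f i (y i)"] by blast
    then show ?thesis
      using y le g[OF yP] by auto
  qed
  fix p q and u v :: real
  assume pq: "p \<in> ereal_epigraph ?P g" "q \<in> ereal_epigraph ?P g" and uv: "0 \<le> u" "0 \<le> v" "u + v = 1"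
  obtain y r z s where p: "p = (y, r)" and q: "q = (z, s)"
    by (cases p, cases q) auto
  obtain a where a: "\<And>i. y i \<in> topspace (X i)" "\<And>i. f i (y i) = ereal (a i)" "(\<Sum>i\<in>UNIV. a i) \<le> r"
    using real_values pq(1) p by blast
  obtain b where b: "\<And>i. z i \<in> topspace (X i)" "\<And>i. f i (z i) = ereal (b i)" "(\<Sum>i\<in>UNIV. b i) \<le> s"
    using real_values pq(2) q by blast
  have comp: "u *\<^sub>R y i + v *\<^sub>R z i \<in> topspace (X i) \<and>
      f i (u *\<^sub>R y i + v *\<^sub>R z i) \<le> ereal (u * a i + v * b i)" for i
  proof -
    have "u *\<^sub>R (y i, a i) + v *\<^sub>R (z i, b i) \<in> ereal_epigraph (X i) (f i)"
      using f(2)[of i] a b uv unfolding convex_function_def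
      by (intro convexD) (auto simp: ereal_epigraph_def)
    then show ?thesis
      by (simp add: ereal_epigraph_def)
  qed
  have "u *\<^sub>R y + v *\<^sub>R z \<in> topspace ?P"
    unfolding mem_topspace_product using comp by (simp add: scaleR_fun_def)
  moreover have "g (u *\<^sub>R y + v *\<^sub>R z) \<le> ereal (u * r + v * s)"
  proof -
    have "g (u *\<^sub>R y + v *\<^sub>R z) = (\<Sum>i\<in>UNIV. f i (u *\<^sub>R y i + v *\<^sub>R z i))"
      using g[OF calculation] by (simp add: scaleR_fun_def)
    also have "\<dots> \<le> (\<Sum>i\<in>UNIV. ereal (u * a i + v * b i))"
      using comp by (intro sum_mono) simp
    also have "\<dots> = ereal (u * (\<Sum>i\<in>UNIV. a i) + v * (\<Sum>i\<in>UNIV. b i))"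
      by (simp add: sum.distrib sum_distrib_left)
    also have "\<dots> \<le> ereal (u * r + v * s)"
      using a(3) b(3) uv by (simp add: add_mono mult_left_mono)
    finally show ?thesis .
  qed
  ultimately show "u *\<^sub>R p + v *\<^sub>R q \<in> ereal_epigraph ?P g"
    unfolding p q ereal_epigraph_def by simp
qed

lemma convex_eps_subdifferential:
  assumes X: "separated_lcs X"
  shows "convex (eps_subdifferential X \<epsilon> f x)"
proof (cases "x \<in> topspace X \<and> \<bar>f x\<bar> \<noteq> \<infinity>")
  case True
  then obtain \<gamma> where \<gamma>: "f x = ereal \<gamma>"
    by (cases "f x") auto
  have sub: "eps_subdifferential X \<epsilon> f x =
      {\<phi> \<in> lcs_dual X. \<forall>y\<in>topspace X. f y - f x \<ge> ereal (\<phi> (y - x) - \<epsilon>)}"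
    using True by (simp add: eps_subdifferential_def)
  show ?thesis
  proof (rule convexI)
    fix \<phi> \<psi> and u v :: real
    assume *: "\<phi> \<in> eps_subdifferential X \<epsilon> f x" "\<psi> \<in> eps_subdifferential X \<epsilon> f x"
      "0 \<le> u" "0 \<le> v" "u + v = 1"
    have "u *\<^sub>R \<phi> + v *\<^sub>R \<psi> \<in> lcs_dual X"
      using * subspace_lcs_dual[OF X] unfolding sub
      by (intro subspace_add subspace_scale) auto
    moreover have "ereal ((u *\<^sub>R \<phi> + v *\<^sub>R \<psi>) (y - x) - \<epsilon>) \<le> f y - f x" if "y \<in> topspace X" for y
    proof (rule ereal_le_real)
      fix r assume "f y - f x \<le> ereal r"
      moreover have "ereal (\<phi> (y - x) - \<epsilon>) \<le> f y - f x" "ereal (\<psi> (y - x) - \<epsilon>) \<le> f y - f x"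
        using *(1,2) that unfolding sub by blast+
      ultimately have "ereal (\<phi> (y - x) - \<epsilon>) \<le> ereal r" "ereal (\<psi> (y - x) - \<epsilon>) \<le> ereal r"
        using order_trans by blast+
      then have "\<phi> (y - x) \<le> r + \<epsilon>" "\<psi> (y - x) \<le> r + \<epsilon>"
        by simp_all
      then have "u * \<phi> (y - x) + v * \<psi> (y - x) \<le> r + \<epsilon>"
        using *(3-5) by (intro convex_bound_le)
      then show "ereal ((u *\<^sub>R \<phi> + v *\<^sub>R \<psi>) (y - x) - \<epsilon>) \<le> ereal r"
        by (simp add: scaleR_fun_def)
    qed
    ultimately show "u *\<^sub>R \<phi> + v *\<^sub>R \<psi> \<in> eps_subdifferential X \<epsilon> f x"
      unfolding sub by blast
  qed
next
  case False
  then have "eps_subdifferential X \<epsilon> f x = {}"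
    unfolding eps_subdifferential_def by (rule if_not_P)
  then show ?thesis by simp
qed

text \<open>
  Moving only the coordinate \<open>i\<close> of \<open>x\<close> leaves the other terms unchanged, and these are finite, so
  they cancel.
\<close>

lemma separable_eps_subgradient_components:
  fixes X :: "'m::finite \<Rightarrow> 'a::real_vector topology"
  assumes X: "\<And>i. separated_lcs (X i)"
    and x: "\<And>i. x i \<in> topspace (X i)" "\<And>i. f i (x i) = ereal (a i)"
    and \<phi>: "\<And>i. \<phi> i \<in> lcs_dual (X i)"
    and le: "\<And>y. (\<And>i. y i \<in> topspace (X i)) \<Longrightarrow>
      ereal ((\<Sum>i\<in>UNIV. a i) + (\<Sum>i\<in>UNIV. \<phi> i (y i - x i)) - \<epsilon>) \<le> (\<Sum>i\<in>UNIV. f i (y i))"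
  shows "\<phi> i \<in> eps_subdifferential (X i) \<epsilon> (f i) (x i)"
proof -
  have zero: "\<phi> j 0 = 0" for j
    using lcs_dual_scaleR[of "\<phi> j" "X j" "x j" 0] \<phi> x(1) by simp
  have "ereal (\<phi> i (b - x i) - \<epsilon>) \<le> f i b - f i (x i)" if b: "b \<in> topspace (X i)" for b
  proof -
    define y where "y = x(i := b)"
    have "(\<Sum>j\<in>UNIV. \<phi> j (y j - x j)) = \<phi> i (b - x i)"
      by (subst sum.remove[of UNIV i]) (auto simp: y_def zero intro!: sum.neutral)
    moreover have "(\<Sum>j\<in>UNIV. f j (y j)) = f i b + ereal (\<Sum>j\<in>UNIV - {i}. a j)"
      by (subst sum.remove[of UNIV i]) (auto simp: y_def x(2))
    moreover have "(\<Sum>j\<in>UNIV. a j) = a i + (\<Sum>j\<in>UNIV - {i}. a j)"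
      by (rule sum.remove) auto
    moreover have "y j \<in> topspace (X j)" for j
      using b x(1) by (simp add: y_def)
    ultimately have "ereal (a i + (\<Sum>j\<in>UNIV - {i}. a j) + \<phi> i (b - x i) - \<epsilon>)
        \<le> f i b + ereal (\<Sum>j\<in>UNIV - {i}. a j)"
      using le[of y] by simp
    then show ?thesis
      by (cases "f i b") (auto simp: x(2))
  qed
  then show ?thesis
    using x \<phi> by (simp add: eps_subdifferential_def)
qed

text \<open>
  A functional in both the annihilator and the product of the \<open>\<epsilon>\<close>-subdifferentials exists as soon as
  \<open>0\<close> lies in the sum of these two sets. If it does not, the closed sum is separated from \<open>0\<close> by a
  point \<open>d\<close>, which belongs to \<open>S\<close>; but in every direction of \<open>S\<close> there are
  \<open>\<epsilon>\<close>-subgradients that are arbitrarily small.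
\<close>

lemma eps_minimizer_annihilating_subgradients:
  fixes X :: "'m::finite \<Rightarrow> 'a::real_vector topology"
  defines "P \<equiv> product_topology X UNIV"
  assumes X: "\<And>i. separated_lcs (X i)"
    and f: "\<And>i. proper_function (X i) (f i)" "\<And>i. convex_function (X i) (f i)"
    and S: "subspace S" "closedin P S"
    and g: "\<And>y. y \<in> topspace P \<Longrightarrow> g y = (\<Sum>i\<in>UNIV. f i (y i))"
    and g_hull: "\<And>y. y \<in> effective_domain P (lsc_hull P g) \<inter> S \<Longrightarrow> g y = lsc_hull P g y"
    and x: "x \<in> S" "\<And>i. f i (x i) = ereal (a i)" and \<epsilon>: "0 < \<epsilon>"
    and minimizer: "\<And>y. y \<in> S \<Longrightarrow> ereal ((\<Sum>i\<in>UNIV. a i) - \<epsilon>) < (\<Sum>i\<in>UNIV. f i (y i))"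
    and sum_closed: "closedin (product_topology (\<lambda>i. weak_star (X i)) UNIV)
        (annihilator X S + (\<Pi> i\<in>UNIV. eps_subdifferential (X i) \<epsilon> (f i) (x i)))"
  obtains \<phi> where "\<phi> \<in> annihilator X S"
    "\<And>i. \<phi> i \<in> eps_subdifferential (X i) \<epsilon> (f i) (x i)"
proof -
  let ?B = "\<Pi> i\<in>UNIV. eps_subdifferential (X i) \<epsilon> (f i) (x i)"
  let ?C = "annihilator X S + ?B"
  have ann: "subspace (annihilator X S)"
    using X by (rule subspace_annihilator)
  have memP: "y \<in> topspace P \<longleftrightarrow> (\<forall>i. y i \<in> topspace (X i))" for y
    unfolding P_def by (rule mem_topspace_product)
  have SP: "S \<subseteq> topspace P"
    using S(2) by (rule closedin_subset)
  have xX: "\<And>i. x i \<in> topspace (X i)"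
    using x(1) SP memP by blast
  have "0 \<in> ?C"
  proof (rule ccontr)
    assume "0 \<notin> ?C"
    have "convex ?B"
      using convex_eps_subdifferential[OF X] by (auto simp: convex_def Pi_iff scaleR_fun_def plus_fun_def)
    then have "convex ?C"
      by (rule convex_set_plus[OF subspace_imp_convex[OF ann]])
    then obtain d where d: "\<And>i. d i \<in> topspace (X i)" "\<And>\<phi>. \<phi> \<in> ?C \<Longrightarrow> 1 \<le> (\<Sum>i\<in>UNIV. \<phi> i (d i))"
      using weak_star_separation[of X ?C] X sum_closed \<open>0 \<notin> ?C\<close> by blast
    have C_small: "\<exists>\<phi>\<in>?B. \<bar>\<Sum>i\<in>UNIV. \<phi> i (e i)\<bar> \<le> 1 / 2" if "e \<in> S" for e
    proof -
      have e: "\<And>i. e i \<in> topspace (X i)"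
        using that SP memP by blast
      have gx: "g x = ereal (\<Sum>i\<in>UNIV. a i)"
        using g[of x] x SP by auto
      have segment: "(x + t *\<^sub>R e, (\<Sum>i\<in>UNIV. a i) - \<epsilon>) \<notin>
          prod_topology P euclideanreal closure_of ereal_epigraph P g" for t
      proof
        let ?y = "x + t *\<^sub>R e"
        assume "(?y, (\<Sum>i\<in>UNIV. a i) - \<epsilon>) \<in> prod_topology P euclideanreal closure_of ereal_epigraph P g"
        then have "(?y, (\<Sum>i\<in>UNIV. a i) - \<epsilon>) \<in> ereal_epigraph P (lsc_hull P g)"
          by (simp add: ereal_epigraph_lsc_hull)
        then have hull: "?y \<in> topspace P" "lsc_hull P g ?y \<le> ereal ((\<Sum>i\<in>UNIV. a i) - \<epsilon>)"
          unfolding ereal_epigraph_def by auto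
        have yS: "?y \<in> S"
          using S(1) x(1) that by (intro subspace_add subspace_scale)
        have "?y \<in> effective_domain P (lsc_hull P g)"
          using hull unfolding effective_domain_def by auto
        then have "g ?y \<le> ereal ((\<Sum>i\<in>UNIV. a i) - \<epsilon>)"
          using g_hull yS hull(2) by simp
        then show False
          using minimizer[OF yS] g[OF hull(1)] by simp
      qed
      \<comment> \<open>With T = 2 * \<epsilon> the bound \<epsilon> / T is 1 / 2, below the bound 1 of the separation.\<close>
      obtain \<phi> where \<phi>: "\<And>i. \<phi> i \<in> lcs_dual (X i)"
        "\<And>y. (\<And>i. y i \<in> topspace (X i)) \<Longrightarrow>
          ereal ((\<Sum>i\<in>UNIV. a i) + (\<Sum>i\<in>UNIV. \<phi> i (y i - x i)) - \<epsilon>) \<le> g y"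
        "\<bar>\<Sum>i\<in>UNIV. \<phi> i (e i)\<bar> \<le> \<epsilon> / (2 * \<epsilon>)"
      proof (rule eps_subgradient_small_along_segment[of X g x "\<Sum>i\<in>UNIV. a i" e \<epsilon> "2 * \<epsilon>"])
        show "convex (ereal_epigraph (product_topology X UNIV) g)"
          using X f g unfolding P_def by (rule convex_separable_sum)
      qed (use X xX gx e \<epsilon> segment in \<open>auto simp: P_def\<close>)
      have minorant: "ereal ((\<Sum>i\<in>UNIV. a i) + (\<Sum>i\<in>UNIV. \<phi> i (y i - x i)) - \<epsilon>)
          \<le> (\<Sum>i\<in>UNIV. f i (y i))" if "\<And>i. y i \<in> topspace (X i)" for y
        using \<phi>(2)[OF that] g[of y] memP that by simp
      have "\<phi> i \<in> eps_subdifferential (X i) \<epsilon> (f i) (x i)" for i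
        using X xX x(2) \<phi>(1) minorant
        by (rule separable_eps_subgradient_components[of X x f a \<phi>])
      then show ?thesis
        using \<phi>(3) \<epsilon> by (intro bexI[of _ \<phi>]) auto
    qed
    have "(\<Sum>i\<in>UNIV. \<psi> i (d i)) = 0" if \<psi>: "\<psi> \<in> annihilator X S" for \<psi>
    proof -
      obtain \<phi> where \<phi>: "\<phi> \<in> ?B"
        using C_small[OF x(1)] by blast
      show ?thesis
      proof (rule affine_bounded_below_imp_constant)
        fix c :: real
        have "c *\<^sub>R \<psi> + \<phi> \<in> ?C"
          using subspace_scale[OF ann \<psi>] \<phi> by (rule set_plus_intro)
        from d(2)[OF this] show "1 \<le> c * (\<Sum>i\<in>UNIV. \<psi> i (d i)) + (\<Sum>i\<in>UNIV. \<phi> i (d i))"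
          by (simp add: scaleR_fun_def sum.distrib sum_distrib_left)
      qed
    qed
    then have "d \<in> S"
      using closed_subspace_bipolar[of X S d] X S d(1) unfolding P_def by blast
    then obtain \<phi> where \<phi>: "\<phi> \<in> ?B" "\<bar>\<Sum>i\<in>UNIV. \<phi> i (d i)\<bar> \<le> 1 / 2"
      using C_small by blast
    have "0 + \<phi> \<in> ?C"
      using subspace_0[OF ann] \<phi>(1) by (rule set_plus_intro)
    then show False
      using d(2)[of \<phi>] \<phi>(2) by simp
  qed
  then obtain \<psi> \<phi> where *: "\<psi> \<in> annihilator X S" "\<phi> \<in> ?B" "0 = \<psi> + \<phi>"
    by (auto elim: set_plus_elim)
  have "\<phi> = - \<psi>"
    using *(3) by (simp add: eq_neg_iff_add_eq_0 add.commute)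
  then have "\<phi> \<in> annihilator X S"
    using subspace_neg[OF ann *(1)] by simp
  then show ?thesis
    using that *(2) by blast
qed

section \<open>Fenchel duality\<close>

lemma fenchel_young:
  assumes "x \<in> topspace X"
  shows "ereal (\<phi> x) - f x \<le> fenchel_conjugate X f \<phi>"
  unfolding fenchel_conjugate_def using assms by (rule SUP_upper)

lemma fenchel_conjugate_le_of_eps_subgradient:
  assumes X: "separated_lcs X" and x: "x \<in> topspace X" "f x = ereal a"
    and \<phi>: "\<phi> \<in> eps_subdifferential X \<epsilon> f x"
  shows "fenchel_conjugate X f \<phi> \<le> ereal (\<phi> x - a + \<epsilon>)"
  unfolding fenchel_conjugate_def
proof (rule SUP_least)
  fix y assume y: "y \<in> topspace X"
  have dual: "\<phi> \<in> lcs_dual X" and le: "ereal (\<phi> (y - x) - \<epsilon>) \<le> f y - f x"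
    using \<phi> x y by (auto simp: eps_subdifferential_def)
  show "ereal (\<phi> y) - f y \<le> ereal (\<phi> x - a + \<epsilon>)"
    using le lcs_dual_diff[OF X dual y x(1)] x(2) by (cases "f y") auto
qed

lemma weak_duality:
  fixes X :: "'m::finite \<Rightarrow> 'a::real_vector topology"
  assumes f: "\<And>i. proper_function (X i) (f i)" and S: "S \<subseteq> topspace (product_topology X UNIV)"
    and x: "x \<in> S" and \<phi>: "\<phi> \<in> annihilator X S"
  shows "- (\<Sum>i\<in>UNIV. fenchel_conjugate (X i) (f i) (\<phi> i)) \<le> (\<Sum>i\<in>UNIV. f i (x i))"
proof (cases "(\<Sum>i\<in>UNIV. f i (x i)) = \<infinity>")
  case False
  have xX: "\<And>i. x i \<in> topspace (X i)"
    using S x mem_topspace_product[of x X] by blast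
  then have "f i (x i) > - \<infinity>" for i
    using f[of i] by (simp add: proper_function_def)
  moreover have "(\<Sum>i\<in>UNIV. f i (x i)) < \<infinity>"
    using False by (simp add: less_top)
  ultimately obtain a where a: "\<And>i. f i (x i) = ereal (a i)"
    using ereal_sum_finite_imp_real[of "\<lambda>i. f i (x i)"] by blast
  have "(\<Sum>i\<in>UNIV. \<phi> i (x i)) = 0"
    using \<phi> x by (simp add: annihilator_def)
  then have "- (\<Sum>i\<in>UNIV. f i (x i)) = (\<Sum>i\<in>UNIV. ereal (\<phi> i (x i) - a i))"
    by (simp add: a sum_subtractf)
  also have "\<dots> \<le> (\<Sum>i\<in>UNIV. fenchel_conjugate (X i) (f i) (\<phi> i))"
    using fenchel_young[OF xX] a by (intro sum_mono) (metis ereal_minus(1))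
  finally show ?thesis
    using ereal_uminus_le_reorder by blast
qed simp

theorem theorem6:
  fixes X :: "'m::finite \<Rightarrow> 'a::real_vector topology"
    and f :: "'m \<Rightarrow> 'a \<Rightarrow> ereal"
    and S :: "('m \<Rightarrow> 'a) set"
    and g :: "('m \<Rightarrow> 'a) \<Rightarrow> ereal"
  assumes lcs: "\<And>i. separated_lcs (X i)"
    and proper: "\<And>i. proper_function (X i) (f i)"
    and convex: "\<And>i. convex_function (X i) (f i)"
    and S_subspace: "subspace S"
    and S_closed: "closedin (product_topology X UNIV) S"
    and feasible: "(\<Pi> i\<in>UNIV. effective_domain (X i) (f i)) \<inter> S \<noteq> {}"
    and g_def: "\<And>x. x \<in> topspace (product_topology X UNIV) \<Longrightarrow> g x = (\<Sum>i\<in>UNIV. f i (x i))"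
    and proper_hull: "\<And>i. proper_function (X i) (lsc_hull (X i) (f i))"
    and g_hull: "\<And>x. x \<in> effective_domain (product_topology X UNIV)
                           (lsc_hull (product_topology X UNIV) g) \<inter> S
                   \<Longrightarrow> g x = lsc_hull (product_topology X UNIV) g x"
    and sum_closed: "\<And>x \<epsilon>. x \<in> (\<Pi> i\<in>UNIV. effective_domain (X i) (f i)) \<inter> S \<Longrightarrow> \<epsilon> > 0 \<Longrightarrow>
           closedin (product_topology (\<lambda>i. weak_star (X i)) UNIV)
             (annihilator X S + (\<Pi> i\<in>UNIV. eps_subdifferential (X i) \<epsilon> (f i) (x i)))"
  shows "(INF x\<in>S. \<Sum>i\<in>UNIV. f i (x i)) =
         (SUP \<phi>\<in>annihilator X S. - (\<Sum>i\<in>UNIV. fenchel_conjugate (X i) (f i) (\<phi> i)))"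
    (is "?vP = ?vD")
proof (rule antisym)
  have SP: "S \<subseteq> topspace (product_topology X UNIV)"
    using S_closed by (rule closedin_subset)
  have SX: "x i \<in> topspace (X i)" if "x \<in> S" for x i
    using that SP mem_topspace_product[of x X] by blast
  have f_lower: "f i (x i) > - \<infinity>" if "x \<in> S" for x i
    using proper[of i] SX[OF that] by (simp add: proper_function_def)
  show "?vD \<le> ?vP"
    using weak_duality[OF proper SP] by (intro SUP_least INF_greatest)
  show "?vP \<le> ?vD"
  proof (cases "?vP = - \<infinity>")
    case False
    obtain z where z: "z \<in> S" "\<And>i. f i (z i) < \<infinity>"
      using feasible by (auto simp: effective_domain_def)
    have "(\<Sum>i\<in>UNIV. f i (z i)) < \<infinity>"
      using z(2) sum_Pinfty[of "\<lambda>i. f i (z i)" UNIV] by (auto simp: less_top)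
    then have "?vP < \<infinity>"
      by (rule le_less_trans[OF INF_lower[OF z(1)]])
    then obtain v where v: "?vP = ereal v"
      using False by (cases ?vP) auto
    define m where "m = real CARD('m)"
    have m: "0 < m"
      by (simp add: m_def)
    have "ereal v \<le> ?vD + ereal \<delta>" if "0 < \<delta>" for \<delta>
    proof -
      \<comment> \<open>Each of the m components loses \<epsilon> in the estimate of its conjugate.\<close>
      define \<epsilon> where "\<epsilon> = \<delta> / m"
      have \<epsilon>: "0 < \<epsilon>"
        using that m by (simp add: \<epsilon>_def)
      have "?vP < ereal (v + \<epsilon>)"
        using v \<epsilon> by simp
      then obtain x where x: "x \<in> S" "(\<Sum>i\<in>UNIV. f i (x i)) < ereal (v + \<epsilon>)"
        by (auto simp: INF_less_iff)
      obtain a where a: "\<And>i. f i (x i) = ereal (a i)"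
        using ereal_sum_finite_imp_real[of "\<lambda>i. f i (x i)"] f_lower[OF x(1)] x(2)
        by (metis ereal_infty_less(1) less_ereal.simps(2) less_trans)
      have v_le: "ereal v \<le> (\<Sum>i\<in>UNIV. f i (y i))" if "y \<in> S" for y
        using INF_lower[OF that, of "\<lambda>x. \<Sum>i\<in>UNIV. f i (x i)"] v by simp
      have minimizer: "ereal ((\<Sum>i\<in>UNIV. a i) - \<epsilon>) < (\<Sum>i\<in>UNIV. f i (y i))" if "y \<in> S" for y
      proof -
        have "ereal ((\<Sum>i\<in>UNIV. a i) - \<epsilon>) < ereal v"
          using x(2) a by simp
        then show ?thesis
          using v_le[OF that] by (rule less_le_trans)
      qed
      have "x \<in> (\<Pi> i\<in>UNIV. effective_domain (X i) (f i)) \<inter> S"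
        using x(1) SX a by (auto simp: effective_domain_def)
      then obtain \<phi> where \<phi>: "\<phi> \<in> annihilator X S"
        "\<And>i. \<phi> i \<in> eps_subdifferential (X i) \<epsilon> (f i) (x i)"
        using eps_minimizer_annihilating_subgradients[OF lcs proper convex S_subspace S_closed g_def g_hull
            x(1) a \<epsilon> minimizer sum_closed[OF _ \<epsilon>]] by blast
      have "(\<Sum>i\<in>UNIV. fenchel_conjugate (X i) (f i) (\<phi> i)) \<le> (\<Sum>i\<in>UNIV. ereal (\<phi> i (x i) - a i + \<epsilon>))"
        using fenchel_conjugate_le_of_eps_subgradient[OF lcs SX[OF x(1)] a \<phi>(2)] by (intro sum_mono)
      also have "\<dots> = ereal (\<delta> - (\<Sum>i\<in>UNIV. a i))"
      proof -
        have "(\<Sum>i\<in>UNIV. \<phi> i (x i)) = 0"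
          using \<phi>(1) x(1) by (simp add: annihilator_def)
        then show ?thesis
          using m by (simp add: sum.distrib sum_subtractf \<epsilon>_def m_def)
      qed
      finally have "ereal ((\<Sum>i\<in>UNIV. a i) - \<delta>) \<le> - (\<Sum>i\<in>UNIV. fenchel_conjugate (X i) (f i) (\<phi> i))"
        by (cases "\<Sum>i\<in>UNIV. fenchel_conjugate (X i) (f i) (\<phi> i)") auto
      also have "\<dots> \<le> ?vD"
        using \<phi>(1) by (rule SUP_upper)
      finally have "ereal ((\<Sum>i\<in>UNIV. a i) - \<delta>) \<le> ?vD" .
      then have "ereal (\<Sum>i\<in>UNIV. a i) \<le> ?vD + ereal \<delta>"
        by (cases ?vD) auto
      then show ?thesis
        using v_le[OF x(1)] unfolding a sum_ereal by (rule order_trans[rotated])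
    qed
    then show ?thesis
      unfolding v by (rule ereal_le_epsilon2)
  qed simp
qed

end
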